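(* Let $1<p<\infty$. Let $\mathbb{C}^+=\{z\in\mathbb{C}:\operatorname{Im}(z)>0\}$, $\mathbb{C}_+=\{z\in\mathbb{C}:\operatorname{Re}(z)>0\}$ and $\mathbb{C}^{++}=\mathbb{C}_+\cap\mathbb{C}^+$. Then $$A^p(\mathbb{C}^+)+A^p(\mathbb{C}_+)=A^p(\mathbb{C}^{++}).$$
   Context: For an open set $\Omega\subset\mathbb{C}$ and $1\le p<\infty$, the Bergman space $A^p(\Omega)$ consists of all holomorphic functions $f$ on $\Omega$ with $\int_\Omega |f(x+iy)|^p\,dx\,dy<+\infty$. The sum $A^p(\mathbb{C}^+)+A^p(\mathbb{C}_+)$ is the set of functions on $\mathbb{C}^{++}$ of the form $f_1|_{\mathbb{C}^{++}}+f_2|_{\mathbb{C}^{++}}$ with $f_1\in A^p(\mathbb{C}^+)$, $f_2\in A^p(\mathbb{C}_+)$. *)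

theory Defs
  imports "HOL-Analysis.Analysis"
begin

text \<open>
  A function on \<open>\<Omega>\<close> is represented by an element of \<^term>\<open>extensional \<Omega>\<close> (constantly
  \<^term>\<open>undefined\<close> off \<open>\<Omega>\<close>), so that equality of functions is equality on \<open>\<Omega>\<close>.
  The measure \<^term>\<open>lborel :: complex measure\<close> is planar Lebesgue measure \<open>dx dy\<close>.
\<close>

definition bergman_space :: "real \<Rightarrow> complex set \<Rightarrow> (complex \<Rightarrow> complex) set" where
  "bergman_space p \<Omega> =
     {f \<in> extensional \<Omega>. f holomorphic_on \<Omega> \<and>
        set_integrable lborel \<Omega> (\<lambda>z. cmod (f z) powr p)}"

definition sum_on ::
  "complex set \<Rightarrow> (complex \<Rightarrow> complex) set \<Rightarrow> (complex \<Rightarrow> complex) set \<Rightarrow> (complex \<Rightarrow> complex) set"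
where
  "sum_on \<Omega> A B = {restrict (\<lambda>z. f1 z + f2 z) \<Omega> | f1 f2. f1 \<in> A \<and> f2 \<in> B}"

definition upper_half_plane :: "complex set" where
  "upper_half_plane = {z. Im z > 0}"

definition right_half_plane :: "complex set" where
  "right_half_plane = {z. Re z > 0}"

definition first_quadrant :: "complex set" where
  "first_quadrant = right_half_plane \<inter> upper_half_plane"

end

theory Submission
  imports Defs "HOL-Complex_Analysis.Complex_Analysis"
begin

text \<open>
  Let \<open>f\<close> be in the Bergman space of the quadrant and put \<open>g z = f z * z powr s\<close> with
  \<open>s = 2 / p - 1 / 2\<close>. By Fubini there are slopes \<open>m1 < 1 < m2\<close> such that \<open>f\<close> restricted to the
  ray of slope \<open>m1\<close> or \<open>m2\<close> is in \<open>L^p(t dt)\<close>. Let \<open>F1\<close>, \<open>F2\<close> be the Cauchy integrals of \<open>g\<close> over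
  these rays. Each is holomorphic off its ray, and Cauchy's formula for the sector between the
  rays gives \<open>F1 - F2 = g\<close> there. Hence \<open>F1\<close> above the first ray and \<open>g + F2\<close> below the second one
  glue to a holomorphic function on the upper half plane, \<open>g - F1\<close> and \<open>- F2\<close> glue to one on the
  right half plane, and these two functions add up to \<open>g\<close>. Dividing by \<open>z powr s\<close> decomposes \<open>f\<close>.
  Choosing between the two formulas according to the side of the diagonal, one only
  evaluates \<open>F1\<close> and \<open>F2\<close> at points \<open>z\<close> whose distance to \<open>t (1 + i m)\<close> is comparable to
  \<open>t + |z|\<close>; there \<open>F z / z powr s\<close> is in \<open>L^p\<close> by a Schur test for the kernel
  \<open>(t / |z|) powr s / (t + |z|)\<close>, for which the exponent \<open>s\<close> is tailored.
\<close>

section \<open>Hardy-type integral inequalities\<close>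

lemma measurable_Complex [measurable (raw)]:
  assumes [measurable]: "f \<in> borel_measurable M" "g \<in> borel_measurable M"
  shows "(\<lambda>x. Complex (f x) (g x)) \<in> borel_measurable M"
  unfolding Complex_eq by measurable

text \<open>Lebesgue measure is determined by its values on boxes, and a box in the plane is a
  product of two intervals. This opens the way to Tonelli in real and imaginary part.\<close>

lemma lborel_complex: "(lborel :: complex measure) = distr (lborel \<Otimes>\<^sub>M lborel) borel (\<lambda>(x, y). Complex x y)"
proof (rule lborel_eqI)
  fix l u :: complex
  assume lu: "\<And>b. b \<in> Basis \<Longrightarrow> l \<bullet> b \<le> u \<bullet> b"
  have le: "Re l \<le> Re u" "Im l \<le> Im u"
    using lu[of 1] lu[of \<i>] by (auto simp: Basis_complex_def)
  have "(\<lambda>(x, y). Complex x y) -` box l u \<inter> space (lborel \<Otimes>\<^sub>M lborel) = {Re l<..<Re u} \<times> {Im l<..<Im u}"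
    by (auto simp: box_def Basis_complex_def space_pair_measure)
  then show "emeasure (distr (lborel \<Otimes>\<^sub>M lborel) borel (\<lambda>(x, y). Complex x y)) (box l u) = (\<Prod>b\<in>Basis. (u - l) \<bullet> b)"
    using le by (subst emeasure_distr)
      (auto simp: lborel.emeasure_pair_measure_Times Basis_complex_def ennreal_mult case_prod_beta)
qed simp

lemma nn_integral_complex:
  fixes f :: "complex \<Rightarrow> ennreal"
  assumes [measurable]: "f \<in> borel_measurable borel"
  shows "(\<integral>\<^sup>+z. f z \<partial>lborel) = (\<integral>\<^sup>+x. \<integral>\<^sup>+y. f (Complex x y) \<partial>lborel \<partial>lborel)"
proof -
  have "(\<integral>\<^sup>+z. f z \<partial>lborel) = (\<integral>\<^sup>+w. f (case w of (x, y) \<Rightarrow> Complex x y) \<partial>(lborel \<Otimes>\<^sub>M lborel))"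
    by (subst lborel_complex, subst nn_integral_distr) (auto simp: case_prod_beta)
  also have "\<dots> = (\<integral>\<^sup>+x. \<integral>\<^sup>+y. f (Complex x y) \<partial>lborel \<partial>lborel)"
    by (subst lborel.nn_integral_fst[symmetric]) (auto simp: case_prod_beta)
  finally show ?thesis .
qed

text \<open>Split at \<open>t = r\<close>. Below, \<open>(t + r) powr - k\<close> is at most
  \<open>r powr - k\<close> and \<open>t powr - b\<close> is integrable at 0 because
  \<open>b < 1\<close>; above, \<open>(t + r) powr - k\<close> is at most \<open>t powr - k\<close>
  and \<open>t powr - (b + k)\<close> is integrable at infinity because \<open>1 < b + k\<close>.
  The two integrals give the two summands of the constant.\<close>

lemma nn_integral_powr_kernel_le:
  fixes b k r :: real
  assumes "b < 1" "0 \<le> k" "1 < b + k" "0 < r"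
  shows "(\<integral>\<^sup>+t. indicator {0<..} t * ennreal (t powr - b * (t + r) powr - k) \<partial>lborel)
    \<le> ennreal ((1 / (1 - b) + 1 / (b + k - 1)) * r powr (1 - b - k))"
proof -
  have near: "(\<integral>\<^sup>+t. ennreal (t powr - b * indicator {0..r} t) \<partial>lborel) = ennreal (r powr (1 - b) / (1 - b))"
  proof (rule nn_integral_has_integral_lborel)
    have "((\<lambda>t. if t \<in> {0..r} then t powr - b else 0) has_integral r powr (1 - b) / (1 - b)) UNIV"
      using has_integral_powr_from_0[of "-b" r] assms by (simp only: has_integral_restrict_UNIV) simp
    then show "((\<lambda>t. t powr - b * indicator {0..r} t) has_integral r powr (1 - b) / (1 - b)) UNIV"
      by (rule has_integral_eq[rotated]) (auto simp: indicator_def)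
  qed auto
  have far: "(\<integral>\<^sup>+t. ennreal (t powr - (b + k) * indicator {r..} t) \<partial>lborel) = ennreal (r powr (1 - b - k) / (b + k - 1))"
  proof (rule nn_integral_has_integral_lborel)
    have "- (r powr (- (b + k) + 1)) / (- (b + k) + 1) = r powr (1 - b - k) / (b + k - 1)"
      using assms by (simp add: field_simps)
    then have "((\<lambda>t. t powr - (b + k)) has_integral r powr (1 - b - k) / (b + k - 1)) {r..}"
      using has_integral_powr_to_inf[of "- (b + k)" r] assms by simp
    then have "((\<lambda>t. if t \<in> {r..} then t powr - (b + k) else 0) has_integral r powr (1 - b - k) / (b + k - 1)) UNIV"
      by (simp only: has_integral_restrict_UNIV)
    then show "((\<lambda>t. t powr - (b + k) * indicator {r..} t) has_integral r powr (1 - b - k) / (b + k - 1)) UNIV"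
      by (rule has_integral_eq[rotated]) (auto simp: indicator_def)
  qed auto
  have "(\<integral>\<^sup>+t. indicator {0<..} t * ennreal (t powr - b * (t + r) powr - k) \<partial>lborel)
    \<le> (\<integral>\<^sup>+t. ennreal (r powr - k) * ennreal (t powr - b * indicator {0..r} t) + ennreal (t powr - (b + k) * indicator {r..} t) \<partial>lborel)"
  proof (rule nn_integral_mono)
    fix t :: real
    consider "t \<le> 0" | "0 < t" "t \<le> r" | "r < t" by linarith
    then show "indicator {0<..} t * ennreal (t powr - b * (t + r) powr - k)
      \<le> ennreal (r powr - k) * ennreal (t powr - b * indicator {0..r} t) + ennreal (t powr - (b + k) * indicator {r..} t)"
    proof cases
      case 2
      then have "t powr - b * (t + r) powr - k \<le> r powr - k * t powr - b"
        using assms by (subst mult.commute, intro mult_right_mono powr_mono2') auto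
      then have "ennreal (t powr - b * (t + r) powr - k) \<le> ennreal (r powr - k) * ennreal (t powr - b)"
        by (simp add: ennreal_mult[symmetric] ennreal_leI)
      with 2 show ?thesis by (simp add: add_increasing2)
    next
      case 3
      then have "t powr - b * (t + r) powr - k \<le> t powr - b * t powr - k"
        using assms by (intro mult_left_mono powr_mono2') auto
      with 3 assms show ?thesis by (simp add: powr_add[symmetric] ennreal_leI algebra_simps)
    qed auto
  qed
  also have "\<dots> = ennreal (r powr - k) * ennreal (r powr (1 - b) / (1 - b)) + ennreal (r powr (1 - b - k) / (b + k - 1))"
    unfolding near[symmetric] far[symmetric] by (subst nn_integral_add) (auto simp: nn_integral_cmult)
  also have "\<dots> = ennreal (r powr - k * (r powr (1 - b) / (1 - b)) + r powr (1 - b - k) / (b + k - 1))"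
    using assms by (simp add: ennreal_mult[symmetric] ennreal_plus[symmetric] del: ennreal_plus)
  also have "r powr - k * (r powr (1 - b) / (1 - b)) = r powr (1 - b - k) / (1 - b)"
    by (simp add: powr_add[symmetric] algebra_simps)
  also have "r powr (1 - b - k) / (1 - b) + r powr (1 - b - k) / (b + k - 1)
    = (1 / (1 - b) + 1 / (b + k - 1)) * r powr (1 - b - k)"
    by (simp add: algebra_simps)
  finally show ?thesis .
qed

lemma nn_integral_even:
  fixes f :: "real \<Rightarrow> ennreal"
  assumes [measurable]: "f \<in> borel_measurable borel" and even: "\<And>x. f (- x) = f x"
  shows "(\<integral>\<^sup>+x. f x \<partial>lborel) = 2 * (\<integral>\<^sup>+x. indicator {0<..} x * f x \<partial>lborel)"
proof -
  have "(\<integral>\<^sup>+x. f x \<partial>lborel) = (\<integral>\<^sup>+x. indicator {0<..} x * f x + indicator {..<0} x * f x \<partial>lborel)"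
    using AE_lborel_singleton[of 0] by (intro nn_integral_cong_AE) (auto elim!: eventually_mono simp: indicator_def)
  also have "\<dots> = (\<integral>\<^sup>+x. indicator {0<..} x * f x \<partial>lborel) + (\<integral>\<^sup>+x. indicator {..<0} x * f x \<partial>lborel)"
    by (rule nn_integral_add) auto
  also have "(\<integral>\<^sup>+x. indicator {..<0} x * f x \<partial>lborel) = (\<integral>\<^sup>+x. indicator {0<..} x * f x \<partial>lborel)"
    by (subst nn_integral_real_affine[where c = "-1" and t = 0]) (auto intro!: nn_integral_cong simp: even indicator_def)
  finally show ?thesis by (simp add: mult_2)
qed

text \<open>This replaces Hoelder's inequality: choosing \<open>l\<close> optimally after integration gives the same bound up to a constant.\<close>

lemma powr_tangent_le:
  fixes l y p :: real
  assumes "0 < l" "0 \<le> y" "1 \<le> p"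
  shows "y \<le> l + l powr (1 - p) * y powr p"
proof (cases "y \<le> l")
  case False
  then have "y = y powr (1 - p) * y powr p" using assms by (simp add: powr_add[symmetric])
  also have "\<dots> \<le> l powr (1 - p) * y powr p"
    using False assms by (intro mult_right_mono powr_mono2') auto
  finally show ?thesis using assms by simp
qed (simp add: add_increasing2)

text \<open>Apply \<open>powr_tangent_le\<close> to \<open>t powr (2/p) * u t\<close> under the
  weight \<open>t powr - (1/2) / (t + r)\<close>, integrate, and then optimise over
  \<open>l\<close>. The first term integrates by \<open>nn_integral_powr_kernel_le\<close>, the
  second is \<open>J\<close>. Finiteness of \<open>I\<close> is part of the claim because
  \<open>enn2real\<close> would turn an infinite value into 0.\<close>

lemma hardy_pointwise:
  fixes p s r :: real and u :: "real \<Rightarrow> real"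
  defines "I \<equiv> \<integral>\<^sup>+t. indicator {0<..} t * ennreal (t powr s * u t / (t + r)) \<partial>lborel"
  defines "J \<equiv> \<integral>\<^sup>+t. indicator {0<..} t * ennreal (t powr (3/2) * u t powr p / (t + r)) \<partial>lborel"
  assumes p: "1 < p" and s: "s = 2 / p - 1 / 2" and r: "0 < r"
    and u[measurable]: "u \<in> borel_measurable borel" and u0: "\<And>t. 0 \<le> u t"
    and N: "(\<integral>\<^sup>+t. indicator {0<..} t * ennreal (t * u t powr p) \<partial>lborel) < \<infinity>"
  shows "I < \<infinity>"
    and "ennreal ((r powr - s * enn2real I) powr p) \<le> ennreal (5 powr p * r powr - (3/2)) * J"
proof -
  have J: "J < \<infinity>"
  proof -
    have "J \<le> (\<integral>\<^sup>+t. ennreal (1 / sqrt r) * (indicator {0<..} t * ennreal (t * u t powr p)) \<partial>lborel)"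
      unfolding J_def
    proof (intro nn_integral_mono)
      fix t :: real
      have "t powr (3/2) * u t powr p / (t + r) \<le> 1 / sqrt r * (t * u t powr p)" if "0 < t"
      proof -
        \<comment> \<open>Arithmetic-geometric mean inequality: it makes
          \<open>sqrt t / (t + r)\<close> at most \<open>1 / sqrt r\<close>, so \<open>J\<close> is
          controlled by the integral in \<open>N\<close>.\<close>
        have "2 * (sqrt t * sqrt r) \<le> t + r"
          using sum_squares_bound[of "sqrt t" "sqrt r"] that r by (simp add: algebra_simps)
        then have "sqrt t * sqrt r \<le> t + r" using that r by (smt (verit) mult_nonneg_nonneg real_sqrt_ge_zero)
        then have "sqrt t / (t + r) \<le> 1 / sqrt r" using that r by (simp add: field_simps)
        then have "(t * u t powr p) * (sqrt t / (t + r)) \<le> (t * u t powr p) * (1 / sqrt r)"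
          using that by (intro mult_left_mono) auto
        moreover have "t powr (3/2) = t * sqrt t"
          using that powr_add[of t 1 "1/2"] by (simp add: powr_half_sqrt)
        ultimately show ?thesis by (simp add: algebra_simps)
      qed
      then show "indicator {0<..} t * ennreal (t powr (3/2) * u t powr p / (t + r))
          \<le> ennreal (1 / sqrt r) * (indicator {0<..} t * ennreal (t * u t powr p))"
        using r by (auto simp: indicator_def ennreal_mult[symmetric] intro!: ennreal_leI)
    qed
    also have "\<dots> < \<infinity>" using N by (simp add: nn_integral_cmult ennreal_mult_less_top)
    finally show ?thesis .
  qed
  have split: "I \<le> ennreal (4 * l * r powr - (1/2)) + ennreal (l powr (1 - p)) * J" if l: "0 < l" for l
  proof -
    have "I \<le> (\<integral>\<^sup>+t. ennreal l * (indicator {0<..} t * ennreal (t powr - (1/2) * (t + r) powr - 1))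
        + ennreal (l powr (1 - p)) * (indicator {0<..} t * ennreal (t powr (3/2) * u t powr p / (t + r))) \<partial>lborel)"
      unfolding I_def
    proof (intro nn_integral_mono)
      fix t :: real
      have "t powr s * u t / (t + r) \<le> l * (t powr - (1/2) * (t + r) powr - 1)
          + l powr (1 - p) * (t powr (3/2) * u t powr p / (t + r))" if t: "0 < t"
      proof -
        \<comment> \<open>This is where \<open>s = 2 / p - 1 / 2\<close> enters: the
          \<open>p\<close>-th power of \<open>t powr (2/p) * u t\<close> is
          \<open>t^2 * u t powr p\<close>, and the remaining factor \<open>t powr - (1/2)\<close>
          lowers the exponent to 3/2.\<close>
        have e1: "t powr s * u t = t powr - (1/2) * (t powr (2/p) * u t)"
          using powr_add[of t "-(1/2)" "2/p"] by (simp add: s add.commute)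
        have e2: "t powr - (1/2) * (t powr (2/p) * u t) powr p = t powr (3/2) * u t powr p"
          using t u0[of t] p powr_add[of t "-1/2" 2] by (simp add: powr_mult powr_powr)
        have "t powr s * u t \<le> t powr - (1/2) * (l + l powr (1 - p) * (t powr (2/p) * u t) powr p)"
          unfolding e1 using l p u0[of t] by (intro mult_left_mono powr_tangent_le) auto
        also have "\<dots> = l * t powr - (1/2) + l powr (1 - p) * (t powr (3/2) * u t powr p)"
          unfolding e2[symmetric] by (simp add: algebra_simps)
        finally have "t powr s * u t / (t + r) \<le> (l * t powr - (1/2) + l powr (1 - p) * (t powr (3/2) * u t powr p)) / (t + r)"
          using t r by (intro divide_right_mono) auto
        then show ?thesis using t r by (simp add: powr_minus_divide add_divide_distrib)
      qed
      then show "indicator {0<..} t * ennreal (t powr s * u t / (t + r))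
        \<le> ennreal l * (indicator {0<..} t * ennreal (t powr - (1/2) * (t + r) powr - 1))
        + ennreal (l powr (1 - p)) * (indicator {0<..} t * ennreal (t powr (3/2) * u t powr p / (t + r)))"
        using r l by (auto simp: indicator_def ennreal_mult[symmetric] ennreal_plus[symmetric] simp del: ennreal_plus intro!: ennreal_leI)
    qed
    also have "\<dots> = ennreal l * (\<integral>\<^sup>+t. indicator {0<..} t * ennreal (t powr - (1/2) * (t + r) powr - 1) \<partial>lborel) + ennreal (l powr (1 - p)) * J"
      unfolding J_def by (subst nn_integral_add) (auto simp: nn_integral_cmult)
    \<comment> \<open>With exponents 1/2 and 1 the kernel constant is 2 + 2 = 4.\<close>
    also have "\<dots> \<le> ennreal l * ennreal (4 * r powr - (1/2)) + ennreal (l powr (1 - p)) * J"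
      using nn_integral_powr_kernel_le[of "1/2" 1 r] r
      by (intro add_right_mono mult_left_mono) auto
    also have "ennreal l * ennreal (4 * r powr - (1/2)) = ennreal (4 * l * r powr - (1/2))"
      using l by (simp add: ennreal_mult[symmetric] algebra_simps)
    finally show ?thesis .
  qed
  from split[of 1] J show I: "I < \<infinity>"
    by (auto simp: less_top[symmetric] top_unique)
  define i j where "i = enn2real I" and "j = enn2real J"
  have ij: "I = ennreal i" "J = ennreal j" "0 \<le> i" "0 \<le> j" using I J by (auto simp: i_def j_def less_top)
  have le: "i \<le> 4 * l * r powr - (1/2) + l powr (1 - p) * j" if "0 < l" for l
    using split[OF that] that r ij by (simp add: ennreal_mult[symmetric] ennreal_plus[symmetric] del: ennreal_plus)
  have "(r powr - s * i) powr p \<le> 5 powr p * r powr - (3/2) * j"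
  proof (cases "j = 0")
    case True
    \<comment> \<open>Without the second term in \<open>le\<close>, letting \<open>l\<close> tend to
      0 forces \<open>i\<close> to vanish.\<close>
    have "i \<le> 0 + e" if "0 < e" for e
      using le[of "e / (4 * r powr - (1/2))"] that r True by (simp add: field_simps)
    then have "i \<le> 0" by (rule field_le_epsilon)
    then show ?thesis using ij True by simp
  next
    case False
    then have j: "0 < j" using ij by simp
    \<comment> \<open>this choice balances the two terms of \<open>le\<close>\<close>
    define l where "l = (r powr (1/2) * j) powr (1/p)"
    have l: "0 < l" "l powr p = r powr (1/2) * j" using j r p by (auto simp: l_def powr_powr)
    have "l powr (1 - p) * j = l * (j / l powr p)" using l by (simp add: powr_diff)
    also have "j / l powr p = r powr - (1/2)" using j r l by (simp add: powr_minus_divide)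
    finally have "i \<le> 5 * l * r powr - (1/2)" using le[OF l(1)] by simp
    then have "(r powr - s * i) powr p \<le> (r powr - s * (5 * l * r powr - (1/2))) powr p"
      using ij p by (intro powr_mono2 mult_left_mono) auto
    also have "\<dots> = 5 powr p * (r powr (- s * p) * r powr (1/2) * r powr (- (1/2) * p)) * j"
      using l r p j by (simp add: powr_mult powr_powr)
    \<comment> \<open>Since \<open>s * p = 2 - p / 2\<close>, the exponents \<open>- s * p\<close>,
      \<open>1/2\<close> and \<open>- p / 2\<close> add up to \<open>-3/2\<close>.\<close>
    also have "r powr (- s * p) * r powr (1/2) * r powr (- (1/2) * p) = r powr - (3/2)"
      using p unfolding powr_add[symmetric] by (intro arg_cong2[where f="(powr)"] refl) (simp add: s field_simps)
    finally show ?thesis .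
  qed
  then show "ennreal ((r powr - s * enn2real I) powr p) \<le> ennreal (5 powr p * r powr - (3/2)) * J"
    unfolding i_def[symmetric] using ij by (simp add: ennreal_mult[symmetric] ennreal_leI)
qed

text \<open>The kernel at \<open>x + i y\<close> is at most a product of a function of \<open>x\<close> and one of \<open>y\<close>, since
  \<open>|z|\<close> dominates both \<open>|x|\<close> and \<open>|y|\<close>; this avoids polar coordinates.\<close>

lemma nn_integral_complex_kernel_le:
  fixes t :: real
  assumes t: "0 < t"
  shows "(\<integral>\<^sup>+z. ennreal (cmod z powr - (3/2) / (t + cmod z)) \<partial>lborel) \<le> ennreal (256 * t powr - (1/2))"
proof -
  \<comment> \<open>The exponents are half of those in the kernel: the kernel at \<open>z\<close> is
    the square of \<open>m powr - (3/4) * (t + m) powr - (1/2)\<close> with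
    \<open>m = cmod z\<close>, and one factor is bounded through \<open>x\<close>, the other through
    \<open>y\<close>.\<close>
  define h where "h x = \<bar>x\<bar> powr - (3/4) * (t + \<bar>x\<bar>) powr - (1/2)" for x :: real
  have [measurable]: "h \<in> borel_measurable borel" unfolding h_def by measurable
  have h0: "0 \<le> h x" for x by (simp add: h_def)
  have le: "cmod (Complex x y) powr - (3/2) / (t + cmod (Complex x y)) \<le> h x * h y" if "x \<noteq> 0" "y \<noteq> 0" for x y
  proof -
    define m where "m = cmod (Complex x y)"
    have m: "\<bar>x\<bar> \<le> m" "\<bar>y\<bar> \<le> m" "0 < m"
      using abs_Re_le_cmod[of "Complex x y"] abs_Im_le_cmod[of "Complex x y"] that by (auto simp: m_def Complex_eq_0)
    have a: "m powr - (3/4) \<le> \<bar>v\<bar> powr - (3/4)" if "v \<noteq> 0" "\<bar>v\<bar> \<le> m" for v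
      using that by (intro powr_mono2') auto
    have b: "(t + m) powr - (1/2) \<le> (t + \<bar>v\<bar>) powr - (1/2)" if "\<bar>v\<bar> \<le> m" for v
      using that t by (intro powr_mono2') auto
    have "m powr - (3/2) / (t + m) = (m powr - (3/4) * (t + m) powr - (1/2)) * (m powr - (3/4) * (t + m) powr - (1/2))"
    proof -
      have "m powr - (3/4) * m powr - (3/4) = m powr - (3/2)" "(t + m) powr - (1/2) * (t + m) powr - (1/2) = 1 / (t + m)"
        using m t by (auto simp: powr_add[symmetric] powr_minus_divide)
      then show ?thesis by (simp add: mult.assoc mult.left_commute[of "(t + m) powr - (1/2)"])
    qed
    also have "\<dots> \<le> h x * h y"
      unfolding h_def using that m by (intro mult_mono a b) auto
    finally show ?thesis by (simp add: m_def)
  qed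
  have "(\<integral>\<^sup>+z. ennreal (cmod z powr - (3/2) / (t + cmod z)) \<partial>lborel)
    = (\<integral>\<^sup>+x. \<integral>\<^sup>+y. ennreal (cmod (Complex x y) powr - (3/2) / (t + cmod (Complex x y))) \<partial>lborel \<partial>lborel)"
    by (rule nn_integral_complex) measurable
  \<comment> \<open>The axes have to be discarded as null sets: \<open>h 0 = 0\<close> by the
    convention for \<open>powr\<close> at 0, so the pointwise bound fails there.\<close>
  also have "\<dots> \<le> (\<integral>\<^sup>+x. \<integral>\<^sup>+y. ennreal (h x) * ennreal (h y) \<partial>lborel \<partial>lborel)"
  proof (rule nn_integral_mono_AE, use AE_lborel_singleton[of "0::real"] in eventually_elim)
    fix x :: real assume x: "x \<noteq> 0"
    show "(\<integral>\<^sup>+y. ennreal (cmod (Complex x y) powr - (3/2) / (t + cmod (Complex x y))) \<partial>lborel)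
      \<le> (\<integral>\<^sup>+y. ennreal (h x) * ennreal (h y) \<partial>lborel)"
    proof (rule nn_integral_mono_AE, use AE_lborel_singleton[of "0::real"] in eventually_elim)
      fix y :: real assume "y \<noteq> 0"
      then show "ennreal (cmod (Complex x y) powr - (3/2) / (t + cmod (Complex x y))) \<le> ennreal (h x) * ennreal (h y)"
        using le[OF x] h0 by (simp add: ennreal_mult[symmetric] ennreal_leI)
    qed
  qed
  also have "\<dots> = (\<integral>\<^sup>+x. ennreal (h x) \<partial>lborel) * (\<integral>\<^sup>+x. ennreal (h x) \<partial>lborel)"
    by (simp add: nn_integral_cmult nn_integral_multc)
  also have "(\<integral>\<^sup>+x. ennreal (h x) \<partial>lborel) \<le> ennreal (16 * t powr - (1/4))"
  proof -
    have "(\<integral>\<^sup>+x. ennreal (h x) \<partial>lborel) = 2 * (\<integral>\<^sup>+x. indicator {0<..} x * ennreal (h x) \<partial>lborel)"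
      by (rule nn_integral_even) (auto simp: h_def)
    also have "(\<integral>\<^sup>+x. indicator {0<..} x * ennreal (h x) \<partial>lborel)
      = (\<integral>\<^sup>+x. indicator {0<..} x * ennreal (x powr - (3/4) * (x + t) powr - (1/2)) \<partial>lborel)"
      by (intro nn_integral_cong) (auto simp: h_def indicator_def algebra_simps)
    \<comment> \<open>Exponents 3/4 and 1/2 give the constant 4 + 4 = 8; evenness doubles it, and
      the product over both coordinates squares 16.\<close>
    also have "\<dots> \<le> ennreal (8 * t powr - (1/4))"
      using nn_integral_powr_kernel_le[of "3/4" "1/2" t] t by simp
    finally have "(\<integral>\<^sup>+x. ennreal (h x) \<partial>lborel) \<le> ennreal 2 * ennreal (8 * t powr - (1/4))"
      by (simp add: mult_left_mono)
    then show ?thesis by (simp add: ennreal_mult[symmetric] del: ennreal_numeral)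
  qed
  then have "(\<integral>\<^sup>+x. ennreal (h x) \<partial>lborel) * (\<integral>\<^sup>+x. ennreal (h x) \<partial>lborel)
     \<le> ennreal (16 * t powr - (1/4)) * ennreal (16 * t powr - (1/4))"
    by (intro mult_mono) auto
  also have "\<dots> = ennreal (256 * t powr - (1/2))"
    using t by (simp add: ennreal_mult[symmetric] powr_add[symmetric] algebra_simps)
  finally show ?thesis .
qed

text \<open>The Schur test. Insert the pointwise bound of \<open>hardy_pointwise\<close>, exchange
  the integrals, and integrate in \<open>z\<close> first: this leaves
  \<open>256 * t powr - (1/2)\<close>, which turns the weight \<open>t powr (3/2)\<close> into the
  weight \<open>t\<close> of \<open>N\<close>.\<close>

lemma hardy_nn_integral:
  fixes p s C :: real and u :: "real \<Rightarrow> real" and F :: "complex \<Rightarrow> complex"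
  defines "I \<equiv> \<lambda>r. \<integral>\<^sup>+t. indicator {0<..} t * ennreal (t powr s * u t / (t + r)) \<partial>lborel"
  assumes p: "1 < p" and s: "s = 2 / p - 1 / 2"
    and u[measurable]: "u \<in> borel_measurable borel" and u0: "\<And>t. 0 \<le> u t"
    and N: "(\<integral>\<^sup>+t. indicator {0<..} t * ennreal (t * u t powr p) \<partial>lborel) < \<infinity>"
    and S: "0 \<notin> S" "0 \<le> C" "\<And>z. z \<in> S \<Longrightarrow> cmod (F z) \<le> C * enn2real (I (cmod z))"
  shows "(\<integral>\<^sup>+z. indicator S z * ennreal (cmod (F z / z powr s) powr p) \<partial>lborel) < \<infinity>"
proof -
  define D where "D = C powr p * 5 powr p"
  have "(\<integral>\<^sup>+z. indicator S z * ennreal (cmod (F z / z powr s) powr p) \<partial>lborel)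
    \<le> (\<integral>\<^sup>+z. \<integral>\<^sup>+t. ennreal D * (indicator {0<..} t * ennreal (t powr (3/2) * u t powr p) *
          ennreal (cmod z powr - (3/2) / (t + cmod z))) \<partial>lborel \<partial>lborel)"
  proof (intro nn_integral_mono)
    fix z :: complex
    let ?r = "cmod z"
    show "indicator S z * ennreal (cmod (F z / z powr s) powr p) \<le>
      (\<integral>\<^sup>+t. ennreal D * (indicator {0<..} t * ennreal (t powr (3/2) * u t powr p) *
          ennreal (?r powr - (3/2) / (t + ?r))) \<partial>lborel)"
    proof (cases "z \<in> S")
      case True
      then have r: "0 < ?r" using S by auto
      have "cmod (F z / z powr s) = ?r powr - s * cmod (F z)"
        by (simp add: norm_divide norm_powr_real_powr' powr_minus field_simps)
      also have "\<dots> \<le> C * (?r powr - s * enn2real (I ?r))"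
        using S(3)[OF True] by (simp add: mult.left_commute[of C] mult_left_mono)
      finally have "ennreal (cmod (F z / z powr s) powr p) \<le> ennreal (C powr p) * ennreal ((?r powr - s * enn2real (I ?r)) powr p)"
        using p S(2) by (auto simp: ennreal_mult[symmetric] powr_mult[symmetric] intro!: ennreal_leI powr_mono2)
      also have "\<dots> \<le> ennreal (C powr p) * (ennreal (5 powr p * ?r powr - (3/2)) *
          (\<integral>\<^sup>+t. indicator {0<..} t * ennreal (t powr (3/2) * u t powr p / (t + ?r)) \<partial>lborel))"
        unfolding I_def by (intro mult_left_mono hardy_pointwise(2)[OF p s r u u0 N]) auto
      also have "\<dots> = (\<integral>\<^sup>+t. ennreal D * (indicator {0<..} t * ennreal (t powr (3/2) * u t powr p) *
          ennreal (?r powr - (3/2) / (t + ?r))) \<partial>lborel)"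
      proof -
        have e1: "(\<integral>\<^sup>+t. ennreal D * (indicator {0<..} t * ennreal (t powr (3/2) * u t powr p) *
            ennreal (?r powr - (3/2) / (t + ?r))) \<partial>lborel)
          = (\<integral>\<^sup>+t. ennreal (C powr p) * (ennreal (5 powr p * ?r powr - (3/2)) *
            (indicator {0<..} t * ennreal (t powr (3/2) * u t powr p / (t + ?r)))) \<partial>lborel)"
        proof (intro nn_integral_cong)
          fix t :: real
          show "ennreal D * (indicator {0<..} t * ennreal (t powr (3/2) * u t powr p) * ennreal (?r powr - (3/2) / (t + ?r)))
            = ennreal (C powr p) * (ennreal (5 powr p * ?r powr - (3/2)) *
              (indicator {0<..} t * ennreal (t powr (3/2) * u t powr p / (t + ?r))))"
          proof (cases "0 < t")
            case True
            have "D * (t powr (3/2) * u t powr p * (?r powr - (3/2) / (t + ?r)))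
              = C powr p * (5 powr p * ?r powr - (3/2) * (t powr (3/2) * u t powr p / (t + ?r)))"
              by (simp add: D_def)
            moreover have "0 \<le> D" "0 \<le> ?r powr - (3/2) / (t + ?r)" "0 \<le> t powr (3/2) * u t powr p / (t + ?r)"
              using True by (auto simp: D_def)
            ultimately show ?thesis using True by (simp add: ennreal_mult[symmetric] del: times_divide_eq_right times_divide_eq_left)
          qed simp
        qed
        have e2: "(\<integral>\<^sup>+t. ennreal (C powr p) * (ennreal (5 powr p * ?r powr - (3/2)) *
            (indicator {0<..} t * ennreal (t powr (3/2) * u t powr p / (t + ?r)))) \<partial>lborel)
          = ennreal (C powr p) * (ennreal (5 powr p * ?r powr - (3/2)) *
            (\<integral>\<^sup>+t. indicator {0<..} t * ennreal (t powr (3/2) * u t powr p / (t + ?r)) \<partial>lborel))"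
        proof -
          define w :: "real \<Rightarrow> ennreal" where "w t = indicator {0<..} t * ennreal (t powr (3/2) * u t powr p / (t + ?r))" for t
          have [measurable]: "w \<in> borel_measurable borel" unfolding w_def by measurable
          show ?thesis unfolding w_def[symmetric] by (simp add: nn_integral_cmult)
        qed
        show ?thesis unfolding e1 e2 by (rule refl)
      qed
      finally show ?thesis using True by simp
    qed simp
  qed
  also have "\<dots> = (\<integral>\<^sup>+t. \<integral>\<^sup>+z. ennreal D * (indicator {0<..} t * ennreal (t powr (3/2) * u t powr p) *
          ennreal (cmod z powr - (3/2) / (t + cmod z))) \<partial>lborel \<partial>lborel)"
    by (rule lborel_pair.Fubini') measurable
  also have "\<dots> \<le> (\<integral>\<^sup>+t. ennreal (D * 256) * (indicator {0<..} t * ennreal (t * u t powr p)) \<partial>lborel)"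
  proof (intro nn_integral_mono)
    fix t :: real
    show "(\<integral>\<^sup>+z. ennreal D * (indicator {0<..} t * ennreal (t powr (3/2) * u t powr p) *
          ennreal (cmod z powr - (3/2) / (t + cmod z))) \<partial>lborel) \<le> ennreal (D * 256) * (indicator {0<..} t * ennreal (t * u t powr p))"
    proof (cases "0 < t")
      case True
      have "(\<integral>\<^sup>+z. ennreal D * (indicator {0<..} t * ennreal (t powr (3/2) * u t powr p) *
          ennreal (cmod z powr - (3/2) / (t + cmod z))) \<partial>lborel)
        = ennreal D * (ennreal (t powr (3/2) * u t powr p) * (\<integral>\<^sup>+z. ennreal (cmod z powr - (3/2) / (t + cmod z)) \<partial>lborel))"
        using True by (simp add: nn_integral_cmult)
      also have "\<dots> \<le> ennreal D * (ennreal (t powr (3/2) * u t powr p) * ennreal (256 * t powr - (1/2)))"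
        by (intro mult_left_mono nn_integral_complex_kernel_le True) auto
      also have "\<dots> = ennreal (D * 256 * (t powr (3/2) * t powr - (1/2) * u t powr p))"
        by (simp add: D_def ennreal_mult[symmetric] algebra_simps)
      also have "t powr (3/2) * t powr - (1/2) = t" using True by (simp add: powr_add[symmetric])
      finally show ?thesis using True by (simp add: D_def ennreal_mult[symmetric])
    qed simp
  qed
  also have "\<dots> < \<infinity>" using N by (simp add: nn_integral_cmult ennreal_mult_less_top)
  finally show ?thesis .
qed

section \<open>Good rays and good vertical lines\<close>

text \<open>For \<open>t > 0\<close> the substitution \<open>y = t * m\<close> has Jacobian
  \<open>t\<close>, so the integral of \<open>N m\<close> over all slopes is at most the planar
  integral of \<open>\<phi>\<close>. Hence \<open>N m\<close> is finite for almost every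
  \<open>m\<close>, and \<open>{a..b}\<close> is not a null set.\<close>

lemma ex_slope_nn_integral_finite:
  fixes \<phi> :: "complex \<Rightarrow> ennreal" and a b :: real
  assumes [measurable]: "\<phi> \<in> borel_measurable borel" and fin: "(\<integral>\<^sup>+z. \<phi> z \<partial>lborel) < \<infinity>" and "a < b"
  shows "\<exists>m\<in>{a..b}. (\<integral>\<^sup>+t. indicator {0<..} t * (ennreal t * \<phi> (Complex t (t * m))) \<partial>lborel) < \<infinity>"
proof -
  define N where "N m = (\<integral>\<^sup>+t. indicator {0<..} t * (ennreal t * \<phi> (Complex t (t * m))) \<partial>lborel)" for m :: real
  have [measurable]: "N \<in> borel_measurable borel" unfolding N_def by measurable
  have "(\<integral>\<^sup>+m. N m \<partial>lborel)
      = (\<integral>\<^sup>+t. \<integral>\<^sup>+m. indicator {0<..} t * (ennreal t * \<phi> (Complex t (t * m))) \<partial>lborel \<partial>lborel)"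
    unfolding N_def by (rule lborel_pair.Fubini') measurable
  also have "\<dots> \<le> (\<integral>\<^sup>+t. \<integral>\<^sup>+y. \<phi> (Complex t y) \<partial>lborel \<partial>lborel)"
  proof (rule nn_integral_mono)
    fix t :: real
    have "(\<integral>\<^sup>+y. \<phi> (Complex t y) \<partial>lborel) = ennreal t * (\<integral>\<^sup>+m. \<phi> (Complex t (t * m)) \<partial>lborel)" if "0 < t"
      using that by (subst nn_integral_real_affine[where c = t and t = 0]) auto
    then show "(\<integral>\<^sup>+m. indicator {0<..} t * (ennreal t * \<phi> (Complex t (t * m))) \<partial>lborel) \<le> (\<integral>\<^sup>+y. \<phi> (Complex t y) \<partial>lborel)"
      by (cases "0 < t") (auto simp: nn_integral_cmult)
  qed
  also have "\<dots> < \<infinity>" using fin by (simp add: nn_integral_complex)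
  finally have "(\<integral>\<^sup>+m. N m \<partial>lborel) \<noteq> \<infinity>" by simp
  then have ae: "AE m in lborel. N m \<noteq> \<infinity>" by (intro nn_integral_PInf_AE) auto
  show ?thesis
  proof (rule ccontr)
    assume "\<not> ?thesis"
    then have "N m = \<infinity>" if "m \<in> {a..b}" for m using that by (auto simp: N_def less_top[symmetric])
    then have "AE m in lborel. m \<notin> {a..b}" using ae by (auto elim!: eventually_mono)
    then have "emeasure lborel {a..b} = 0" by (subst (asm) AE_iff_measurable[where N = "{a..b}"]) auto
    with \<open>a < b\<close> show False by simp
  qed
qed

text \<open>Supplies vertical lines at every scale, with one constant for all of them, for the short
  sides of the contours. If all abscissae in \<open>{X..2*X}\<close> failed, that strip alone would
  carry more than the whole integral.\<close>

lemma ex_abscissa_nn_integral_le: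
  fixes \<phi> :: "complex \<Rightarrow> ennreal"
  assumes [measurable]: "\<phi> \<in> borel_measurable borel" and fin: "(\<integral>\<^sup>+z. \<phi> z \<partial>lborel) < \<infinity>"
  obtains C where "0 \<le> C" "\<And>X. 0 < X \<Longrightarrow> \<exists>x\<in>{X..2*X}. (\<integral>\<^sup>+y. \<phi> (Complex x y) \<partial>lborel) \<le> ennreal (C / x)"
proof
  define M where "M = enn2real (\<integral>\<^sup>+z. \<phi> z \<partial>lborel)"
  have M: "(\<integral>\<^sup>+z. \<phi> z \<partial>lborel) = ennreal M" "0 \<le> M" using fin by (auto simp: M_def)
  \<comment> \<open>The constant is chosen so that \<open>(2 * M + 2) / (2 * X)\<close> on an
    interval of length \<open>X\<close> integrates to \<open>M + 1\<close>, which exceeds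
    \<open>M\<close>.\<close>
  show "0 \<le> 2 * M + 2" using M by simp
  show "\<exists>x\<in>{X..2*X}. (\<integral>\<^sup>+y. \<phi> (Complex x y) \<partial>lborel) \<le> ennreal ((2 * M + 2) / x)" if X: "0 < X" for X
  proof (rule ccontr)
    assume "\<not> ?thesis"
    then have gt: "ennreal ((2 * M + 2) / x) \<le> (\<integral>\<^sup>+y. \<phi> (Complex x y) \<partial>lborel)" if "x \<in> {X..2*X}" for x
      using that by force
    have "ennreal (M + 1) = (\<integral>\<^sup>+x. ennreal ((2 * M + 2) / (2 * X)) * indicator {X..2*X} x \<partial>lborel)"
    proof -
      have "(2 * M + 2) / (2 * X) * X = M + 1" using X by (simp add: field_simps)
      then show ?thesis
        using X M by (subst nn_integral_cmult_indicator) (simp_all add: ennreal_mult[symmetric] del: ennreal_plus)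
    qed
    also have "\<dots> \<le> (\<integral>\<^sup>+x. \<integral>\<^sup>+y. \<phi> (Complex x y) \<partial>lborel \<partial>lborel)"
    proof (rule nn_integral_mono)
      fix x :: real
      have "ennreal ((2 * M + 2) / (2 * X)) \<le> ennreal ((2 * M + 2) / x)" if "x \<in> {X..2*X}"
        using that X M by (intro ennreal_leI divide_left_mono) auto
      then show "ennreal ((2 * M + 2) / (2 * X)) * indicator {X..2*X} x \<le> (\<integral>\<^sup>+y. \<phi> (Complex x y) \<partial>lborel)"
        using gt[of x] by (auto simp: indicator_def intro: order_trans)
    qed
    also have "\<dots> = ennreal M" using M by (simp add: nn_integral_complex)
    finally show False using M by simp
  qed
qed

section \<open>Cauchy integrals over rays\<close>

text \<open>The second-order remainder of \<open>1 / (c t - w)\<close> at \<open>w = z\<close> is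
  \<open>(w - z)^2 / ((c t - w) * (c t - z)^2)\<close>, so the error after integration is at most
  \<open>(cmod (w - z))^2 * K\<close>. The distance \<open>d\<close> is imposed only where
  \<open>h t\<close> is nonzero, so that \<open>h\<close> may carry the indicator of a half
  line.\<close>

lemma has_field_derivative_cauchy_transform:
  fixes h c :: "'a \<Rightarrow> complex"
  assumes [measurable]: "h \<in> borel_measurable M" "c \<in> borel_measurable M"
    and d: "0 < d" "\<And>t. h t \<noteq> 0 \<Longrightarrow> d \<le> cmod (c t - z)"
    and int: "integrable M (\<lambda>t. h t / (c t - z))"
  shows "((\<lambda>w. \<integral>t. h t / (c t - w) \<partial>M) has_field_derivative (\<integral>t. h t / (c t - z)\<^sup>2 \<partial>M)) (at z)"
proof -
  define K where "K = 2 / d\<^sup>2 * (\<integral>t. cmod (h t / (c t - z)) \<partial>M)"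
  have int2: "integrable M (\<lambda>t. h t / (c t - z)\<^sup>2)"
  proof (rule Bochner_Integration.integrable_bound[OF integrable_mult_right[OF integrable_norm[OF int], of "1/d"]])
    show "AE t in M. norm (h t / (c t - z)\<^sup>2) \<le> norm (1 / d * norm (h t / (c t - z)))"
    proof (rule AE_I2)
      fix t
      show "norm (h t / (c t - z)\<^sup>2) \<le> norm (1 / d * norm (h t / (c t - z)))"
      proof (cases "h t = 0")
        case False
        then have "1 / cmod (c t - z) \<le> 1 / d" using d by (intro divide_left_mono mult_pos_pos) force+
        then have "cmod (h t / (c t - z)) * (1 / cmod (c t - z)) \<le> cmod (h t / (c t - z)) * (1 / d)"
          by (rule mult_left_mono) auto
        then show ?thesis using d by (simp add: norm_divide norm_mult power2_eq_square mult.commute)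
      qed simp
    qed
  qed measurable
  have est: "cmod ((\<integral>t. h t / (c t - w) \<partial>M) - (\<integral>t. h t / (c t - z) \<partial>M) - (w - z) * (\<integral>t. h t / (c t - z)\<^sup>2 \<partial>M))
      \<le> (cmod (w - z))\<^sup>2 * K" if w: "cmod (w - z) < d / 2" for w
  proof -
    \<comment> \<open>Moving from \<open>z\<close> to \<open>w\<close> by less than
      \<open>d / 2\<close> at most halves the distance to \<open>c t\<close>.\<close>
    have far: "cmod (c t - z) \<le> 2 * cmod (c t - w)" "d / 2 \<le> cmod (c t - w)" "c t \<noteq> w" "c t \<noteq> z" if "h t \<noteq> 0" for t
      using d(2)[OF that] d(1) w norm_triangle_ineq[of "c t - w" "w - z"] by auto
    have intw: "integrable M (\<lambda>t. h t / (c t - w))"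
    proof (rule Bochner_Integration.integrable_bound[OF integrable_mult_right[OF integrable_norm[OF int], of 2]])
      show "AE t in M. norm (h t / (c t - w)) \<le> norm (2 * norm (h t / (c t - z)))"
      proof (rule AE_I2)
        fix t
        show "norm (h t / (c t - w)) \<le> norm (2 * norm (h t / (c t - z)))"
        proof (cases "h t = 0")
          case False
          then show ?thesis using far[OF False] mult_left_mono[OF far(1)[OF False], of "cmod (h t)"]
            by (simp add: norm_divide field_simps)
        qed simp
      qed
    qed measurable
    have "(\<integral>t. h t / (c t - w) \<partial>M) - (\<integral>t. h t / (c t - z) \<partial>M) - (w - z) * (\<integral>t. h t / (c t - z)\<^sup>2 \<partial>M)
      = (\<integral>t. h t / (c t - w) - h t / (c t - z) - (w - z) * (h t / (c t - z)\<^sup>2) \<partial>M)"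
      using int int2 intw by (simp del: times_divide_eq_right)
    also have "cmod \<dots> \<le> (\<integral>t. (cmod (w - z))\<^sup>2 * (2 / d\<^sup>2) * cmod (h t / (c t - z)) \<partial>M)"
    proof (rule order_trans[OF Bochner_Integration.integral_norm_bound integral_mono])
      fix t
      show "norm (h t / (c t - w) - h t / (c t - z) - (w - z) * (h t / (c t - z)\<^sup>2))
        \<le> (cmod (w - z))\<^sup>2 * (2 / d\<^sup>2) * cmod (h t / (c t - z))"
      proof (cases "h t = 0")
        case False
        note f = far[OF False]
        have "h t / (c t - w) - h t / (c t - z) - (w - z) * (h t / (c t - z)\<^sup>2)
          = (w - z)\<^sup>2 * (1 / ((c t - w) * (c t - z))) * (h t / (c t - z))"
        proof -
          have "k / a - k / b - (b - a) * (k / b\<^sup>2) = (b - a)\<^sup>2 * (1 / (a * b)) * (k / b)"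
            if "a \<noteq> 0" "b \<noteq> 0" for k a b :: complex
            using that by (simp add: field_simps power2_eq_square)
          from this[of "c t - w" "c t - z" "h t"] f(3,4) show ?thesis by simp
        qed
        then have "norm (h t / (c t - w) - h t / (c t - z) - (w - z) * (h t / (c t - z)\<^sup>2))
          = (cmod (w - z))\<^sup>2 * (1 / (cmod (c t - w) * cmod (c t - z))) * cmod (h t / (c t - z))"
          by (simp add: norm_mult norm_divide norm_power)
        also have "1 / (cmod (c t - w) * cmod (c t - z)) \<le> 1 / (d / 2 * d)"
          using f d(1) d(2)[OF False] by (intro divide_left_mono mult_mono mult_pos_pos) auto
        finally show ?thesis by (simp add: mult_left_mono mult_right_mono power2_eq_square)
      qed simp
    qed (use int int2 intw in \<open>auto simp del: times_divide_eq_right\<close>)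
    also have "\<dots> = (cmod (w - z))\<^sup>2 * K" by (simp add: K_def)
    finally show ?thesis .
  qed
  show ?thesis unfolding has_field_derivative_iff
  proof (rule Lim_null[THEN iffD2], rule Lim_null_comparison)
    show "\<forall>\<^sub>F w in at z. norm (((\<integral>t. h t / (c t - w) \<partial>M) - (\<integral>t. h t / (c t - z) \<partial>M)) / (w - z) - (\<integral>t. h t / (c t - z)\<^sup>2 \<partial>M))
      \<le> cmod (w - z) * K"
      unfolding eventually_at
    proof (intro exI[of _ "d/2"] conjI ballI impI)
      fix w assume w: "w \<noteq> z \<and> dist w z < d / 2"
      let ?E = "(\<integral>t. h t / (c t - w) \<partial>M) - (\<integral>t. h t / (c t - z) \<partial>M)" and ?D = "\<integral>t. h t / (c t - z)\<^sup>2 \<partial>M"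
      have "?E / (w - z) - ?D = (?E - (w - z) * ?D) / (w - z)" using w by (simp add: field_simps)
      then have "norm (?E / (w - z) - ?D) = cmod (?E - (w - z) * ?D) / cmod (w - z)" by (simp add: norm_divide)
      also have "\<dots> \<le> (cmod (w - z))\<^sup>2 * K / cmod (w - z)"
        using est[of w] w by (intro divide_right_mono) (auto simp: dist_norm)
      also have "\<dots> = cmod (w - z) * K" using w by (simp add: power2_eq_square)
      finally show "norm (?E / (w - z) - ?D) \<le> cmod (w - z) * K" .
    qed (use d in auto)
    have "((\<lambda>w. cmod (w - z) * K) \<longlongrightarrow> cmod (z - z) * K) (at z)" by (intro tendsto_intros)
    then show "((\<lambda>w. cmod (w - z) * K) \<longlongrightarrow> 0) (at z)" by simp
  qed
qed

text \<open>The functional sending \<open>w\<close> to \<open>Im w - m * Re w\<close> vanishes on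
  the ray of slope \<open>m\<close> and is Lipschitz with constant
  \<open>1 + \<bar>m\<bar>\<close>.\<close>

lemma slope_distance:
  fixes m t :: real and z :: complex
  shows "\<bar>Im z - m * Re z\<bar> \<le> (1 + \<bar>m\<bar>) * cmod (Complex t (t * m) - z)"
proof -
  let ?w = "Complex t (t * m) - z"
  have "\<bar>Im z - m * Re z\<bar> = \<bar>Im ?w - m * Re ?w\<bar>" by (simp add: algebra_simps)
  also have "\<dots> \<le> \<bar>Im ?w\<bar> + \<bar>m\<bar> * \<bar>Re ?w\<bar>" by (metis abs_mult abs_triangle_ineq4)
  also have "\<dots> \<le> cmod ?w + \<bar>m\<bar> * cmod ?w" by (intro add_mono mult_left_mono abs_Im_le_cmod abs_Re_le_cmod) auto
  finally show ?thesis by (simp add: algebra_simps)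
qed

text \<open>The hypothesis places \<open>z\<close> in a cone away from the line of slope
  \<open>m\<close>. There \<open>slope_distance\<close> bounds \<open>cmod z\<close> by a multiple
  of the distance, and the triangle inequality bounds \<open>t\<close> by the distance plus
  \<open>cmod z\<close>; so \<open>cmod z\<close> is counted twice in the constant.\<close>

lemma ray_separation:
  fixes m t c :: real and z :: complex
  assumes "0 < c" "c * cmod z \<le> \<bar>Im z - m * Re z\<bar>"
  shows "t + cmod z \<le> (1 + 2 * (1 + \<bar>m\<bar>) / c) * cmod (Complex t (t * m) - z)"
proof -
  let ?w = "Complex t (t * m) - z"
  have "c * cmod z \<le> (1 + \<bar>m\<bar>) * cmod ?w" using assms slope_distance[of z m t] by linarith
  then have z: "cmod z \<le> (1 + \<bar>m\<bar>) / c * cmod ?w" using assms by (simp add: field_simps)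
  have "t \<le> cmod (Complex t (t * m))" using complex_Re_le_cmod[of "Complex t (t * m)"] by simp
  also have "\<dots> \<le> cmod ?w + cmod z" using norm_triangle_ineq[of ?w z] by simp
  finally have "t + cmod z \<le> cmod ?w + 2 * ((1 + \<bar>m\<bar>) / c * cmod ?w)" using z by simp
  then show ?thesis by (simp add: algebra_simps)
qed

text \<open>The Cauchy integral along the ray from 0 outwards; \<open>Complex 1 m\<close> is the
  derivative of its parametrisation.\<close>

definition ray_transform :: "real \<Rightarrow> (complex \<Rightarrow> complex) \<Rightarrow> complex \<Rightarrow> complex" where
  "ray_transform m g z =
     (\<integral>t. indicator {0<..} t * g (Complex t (t * m)) * Complex 1 m / (Complex t (t * m) - z) \<partial>lborel) / (2 * pi * \<i>)"

text \<open>For \<open>z\<close> off the line of slope \<open>m\<close>, the Cauchy kernel is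
  bounded by a multiple of \<open>1 / (t + cmod z)\<close>, the constant depending on
  \<open>z\<close>. Using only the radius makes one condition serve all these
  \<open>z\<close>.\<close>

definition ray_integrable :: "real \<Rightarrow> (complex \<Rightarrow> complex) \<Rightarrow> bool" where
  "ray_integrable m g \<longleftrightarrow>
     (\<forall>r>0. (\<integral>\<^sup>+t. indicator {0<..} t * ennreal (cmod (g (Complex t (t * m))) / (t + r)) \<partial>lborel) < \<infinity>)"

lemma ray_kernel_bound:
  fixes m t C :: real
  assumes "0 \<le> t" "0 < cmod z" "t + cmod z \<le> C * cmod (Complex t (t * m) - z)"
  shows "cmod (a * b / (Complex t (t * m) - z)) \<le> C * cmod b * (cmod a / (t + cmod z))"
proof -
  let ?w = "Complex t (t * m) - z"
  have w: "0 < cmod ?w" using assms by (metis add_nonneg_pos less_le_not_le mult_zero_right norm_ge_zero order_le_less)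
  have "1 / W \<le> C / q" if "0 < W" "0 < q" "q \<le> C * W" for W q :: real
    using that by (simp add: field_simps)
  from this[OF w _ assms(3)] have "1 / cmod ?w \<le> C / (t + cmod z)" using assms by linarith
  then have "cmod a * cmod b * (1 / cmod ?w) \<le> cmod a * cmod b * (C / (t + cmod z))"
    by (intro mult_left_mono) auto
  then show ?thesis by (simp add: norm_divide norm_mult algebra_simps)
qed

lemma ray_transform_nn_bound:
  fixes m C :: real
  assumes [measurable]: "g \<in> borel_measurable borel"
    and z: "z \<noteq> 0" and C: "0 \<le> C" and sep: "\<And>t. 0 < t \<Longrightarrow> t + cmod z \<le> C * cmod (Complex t (t * m) - z)"
  shows "(\<integral>\<^sup>+t. norm (indicator {0<..} t * g (Complex t (t * m)) * Complex 1 m / (Complex t (t * m) - z)) \<partial>lborel)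
    \<le> ennreal (C * cmod (Complex 1 m)) *
        (\<integral>\<^sup>+t. indicator {0<..} t * ennreal (cmod (g (Complex t (t * m))) / (t + cmod z)) \<partial>lborel)"
proof -
  have "(\<integral>\<^sup>+t. norm (indicator {0<..} t * g (Complex t (t * m)) * Complex 1 m / (Complex t (t * m) - z)) \<partial>lborel)
    \<le> (\<integral>\<^sup>+t. ennreal (C * cmod (Complex 1 m)) *
        (indicator {0<..} t * ennreal (cmod (g (Complex t (t * m))) / (t + cmod z))) \<partial>lborel)"
  proof (rule nn_integral_mono)
    fix t :: real
    show "ennreal (norm (indicator {0<..} t * g (Complex t (t * m)) * Complex 1 m / (Complex t (t * m) - z)))
      \<le> ennreal (C * cmod (Complex 1 m)) * (indicator {0<..} t * ennreal (cmod (g (Complex t (t * m))) / (t + cmod z)))"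
    proof (cases "0 < t")
      case True
      then show ?thesis
        using ray_kernel_bound[OF _ _ sep[OF True], of "g (Complex t (t * m))" "Complex 1 m"] z C
        by (simp add: ennreal_mult[symmetric] ennreal_leI)
    qed simp
  qed
  then show ?thesis by (simp add: nn_integral_cmult)
qed

lemma ray_transform_bound:
  fixes m C :: real
  assumes g: "g \<in> borel_measurable borel" "ray_integrable m g"
    and z: "z \<noteq> 0" and C: "0 \<le> C" and sep: "\<And>t. 0 < t \<Longrightarrow> t + cmod z \<le> C * cmod (Complex t (t * m) - z)"
  shows "cmod (ray_transform m g z) \<le> C * cmod (Complex 1 m) *
     enn2real (\<integral>\<^sup>+t. indicator {0<..} t * ennreal (cmod (g (Complex t (t * m))) / (t + cmod z)) \<partial>lborel)"
proof -
  define h where "h t = indicator {0<..} t * g (Complex t (t * m)) * Complex 1 m / (Complex t (t * m) - z)" for t :: real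
  define I where "I = (\<integral>\<^sup>+t. indicator {0<..} t * ennreal (cmod (g (Complex t (t * m))) / (t + cmod z)) \<partial>lborel)"
  have I: "I < \<infinity>" using g(2) z by (simp add: ray_integrable_def I_def)
  have h: "(\<integral>\<^sup>+t. norm (h t) \<partial>lborel) \<le> ennreal (C * cmod (Complex 1 m)) * I"
    unfolding h_def I_def by (rule ray_transform_nn_bound[OF g(1) z C sep])
  \<comment> \<open>A Bochner integral that does not exist has the value 0, so the bound holds in
    both cases.\<close>
  have "cmod (integral\<^sup>L lborel h) \<le> enn2real (\<integral>\<^sup>+t. norm (h t) \<partial>lborel)"
  proof (cases "integrable lborel h")
    case True
    then show ?thesis using integral_norm_bound[of lborel h] by (simp add: integral_eq_nn_integral)
  qed (simp add: not_integrable_integral_eq)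
  also have "\<dots> \<le> enn2real (ennreal (C * cmod (Complex 1 m)) * I)"
    using I by (intro enn2real_mono h) (simp add: ennreal_mult_less_top)
  also have "\<dots> = C * cmod (Complex 1 m) * enn2real I" using C by (simp add: enn2real_mult)
  finally have *: "cmod (integral\<^sup>L lborel h) \<le> C * cmod (Complex 1 m) * enn2real I" .
  have "cmod (ray_transform m g z) = cmod (integral\<^sup>L lborel h) / (2 * pi)"
    by (simp add: ray_transform_def h_def[abs_def] norm_divide norm_mult)
  also have "\<dots> \<le> cmod (integral\<^sup>L lborel h)" using pi_ge_two by (simp add: divide_le_eq mult_le_cancel_left1)
  finally show ?thesis using * by (simp add: I_def)
qed

lemma ray_transform_integrable:
  fixes m :: real
  assumes [measurable]: "g \<in> borel_measurable borel" and g: "ray_integrable m g" and z: "Im z \<noteq> m * Re z"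
  shows "integrable lborel (\<lambda>t. indicator {0<..} t * g (Complex t (t * m)) * Complex 1 m / (Complex t (t * m) - z))"
proof -
  have z0: "0 < cmod z" using z by auto
  \<comment> \<open>For integrability at a single point the cone constant may depend on
    \<open>z\<close>.\<close>
  define c where "c = \<bar>Im z - m * Re z\<bar> / cmod z"
  have c: "0 < c" "c * cmod z \<le> \<bar>Im z - m * Re z\<bar>" using z z0 by (auto simp: c_def)
  define C where "C = 1 + 2 * (1 + \<bar>m\<bar>) / c"
  have sep: "t + cmod z \<le> C * cmod (Complex t (t * m) - z)" for t
    unfolding C_def by (rule ray_separation[OF c])
  have C: "0 \<le> C" using c by (simp add: C_def)
  have "z \<noteq> 0" using z0 by auto
  show ?thesis
  proof (rule integrableI_bounded)
    show "(\<integral>\<^sup>+t. norm (indicator {0<..} t * g (Complex t (t * m)) * Complex 1 m / (Complex t (t * m) - z)) \<partial>lborel) < \<infinity>"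
      by (rule le_less_trans[OF ray_transform_nn_bound[OF assms(1) \<open>z \<noteq> 0\<close> C sep]])
         (use g z0 in \<open>simp_all add: ray_integrable_def ennreal_mult_less_top\<close>)
  qed measurable
qed

text \<open>Off the line of slope \<open>m\<close>, \<open>slope_distance\<close> keeps the whole
  ray at a positive distance from \<open>z\<close>, so the Cauchy transform is differentiable
  there.\<close>

lemma ray_transform_holomorphic:
  fixes m :: real
  assumes [measurable]: "g \<in> borel_measurable borel" and g: "ray_integrable m g"
    and S: "\<And>z. z \<in> S \<Longrightarrow> Im z \<noteq> m * Re z"
  shows "ray_transform m g holomorphic_on S"
proof -
  have "ray_transform m g field_differentiable at z" if "z \<in> S" for z
  proof -
    define d where "d = \<bar>Im z - m * Re z\<bar> / (1 + \<bar>m\<bar>)"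
    have d: "0 < d" "d \<le> cmod (Complex t (t * m) - z)" for t
      using S[OF that] slope_distance[of z m t] by (auto simp: d_def field_simps intro!: divide_pos_pos)
    note D = has_field_derivative_cauchy_transform[OF _ _ d ray_transform_integrable[OF assms(1) g S[OF that]], simplified]
    show ?thesis
      unfolding ray_transform_def[abs_def] field_differentiable_def using DERIV_cdivide[OF D] by blast
  qed
  then show ?thesis by (auto simp: holomorphic_on_def intro: field_differentiable_at_within)
qed

section \<open>Cauchy's formula for a sector\<close>

text \<open>Multiplication by \<open>Complex 1 m\<close> maps the real segment from \<open>e\<close>
  to \<open>R\<close> onto the slanted one, which reduces the claim to an integral along the real
  axis.\<close>

lemma contour_integral_slanted:
  fixes e R m :: real
  assumes "e < R"
  shows "contour_integral (linepath (Complex e (e * m)) (Complex R (R * m))) f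
    = integral {e..R} (\<lambda>t. f (Complex t (t * m)) * Complex 1 m)"
proof -
  have lin: "linepath (Complex e (e * m)) (Complex R (R * m)) u = of_real ((1 - u) * e + u * R) * Complex 1 m"
    and lin': "linepath (of_real e) (of_real R) u = (of_real ((1 - u) * e + u * R) :: complex)" for u
    by (auto simp: linepath_def complex_eq_iff algebra_simps)
  have "contour_integral (linepath (Complex e (e * m)) (Complex R (R * m))) f
    = contour_integral (linepath (of_real e) (of_real R)) (\<lambda>w. f (w * Complex 1 m) * Complex 1 m)"
    unfolding contour_integral_integral vector_derivative_linepath_at lin lin'
    by (intro integral_cong) (auto simp: complex_eq_iff algebra_simps)
  also have "\<dots> = integral {e..R} (\<lambda>t. f (of_real t * Complex 1 m) * Complex 1 m)"
    using assms by (subst contour_integral_linepath_Reals_eq) auto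
  also have "(\<lambda>t. of_real t * Complex 1 m) = (\<lambda>t. Complex t (t * m))"
    by (auto simp: fun_eq_iff complex_eq_iff)
  finally show ?thesis by (metis (no_types, lifting))
qed

text \<open>The hypothesis says that \<open>z\<close> lies strictly to the left of the directed line
  from \<open>a\<close> to \<open>b\<close>. The segment is then seen from \<open>z\<close> under an
  angle strictly between 0 and pi, and the real part of the winding number is that angle over 2
  pi.\<close>

lemma winding_number_linepath_left:
  assumes "0 < Im ((b - a) * cnj (b - z))"
  shows "z \<notin> closed_segment a b" "0 < Re (winding_number (linepath a b) z)" "Re (winding_number (linepath a b) z) < 1/2"
proof -
  show *: "z \<notin> closed_segment a b"
    using assms by (simp add: closed_segment_def) (force simp: algebra_simps)
  show "0 < Re (winding_number (linepath a b) z)" by (rule winding_number_linepath_pos_lt[OF assms])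
  show "Re (winding_number (linepath a b) z) < 1/2" using winding_number_lt_half_linepath[OF *] by simp
qed

text \<open>The winding number of the closed path is an integer, and it is a sum of four terms with
  real parts strictly between 0 and 1/2. The only integer strictly between 0 and 2 is 1.\<close>

lemma winding_number_quadrilateral:
  assumes "0 < Im ((b - a) * cnj (b - z))" "0 < Im ((c - b) * cnj (c - z))"
    "0 < Im ((d - c) * cnj (d - z))" "0 < Im ((a - d) * cnj (a - z))"
  shows "winding_number (linepath a b +++ linepath b c +++ linepath c d +++ linepath d a) z = 1"
proof -
  note L = assms[THEN winding_number_linepath_left(1)] assms[THEN winding_number_linepath_left(2)] assms[THEN winding_number_linepath_left(3)]
  let ?g = "linepath a b +++ linepath b c +++ linepath c d +++ linepath d a"
  have sum: "winding_number ?g z = winding_number (linepath a b) z + winding_number (linepath b c) z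
      + winding_number (linepath c d) z + winding_number (linepath d a) z"
    using L by (simp add: winding_number_join path_image_join)
  have "winding_number ?g z \<in> \<int>"
    using L by (subst integer_winding_number_eq) (auto simp: path_image_join)
  then obtain n where n: "winding_number ?g z = of_int n" by (auto elim: Ints_cases)
  have "Re (winding_number ?g z) = of_int n" by (simp add: n)
  then have "0 < real_of_int n" "real_of_int n < 2" using L unfolding sum by auto
  then have "n = 1" by linarith
  then show ?thesis using n by simp
qed

text \<open>Cauchy's formula for the trapezoid cut out of the sector by the vertical lines at
  \<open>e\<close> and \<open>R\<close>, run counterclockwise: out along the lower ray, up, back
  along the upper ray, down.\<close>

lemma Cauchy_formula_sector:
  fixes e R m1 m2 :: real and z :: complex
  assumes S: "open S" "convex S" and g: "g holomorphic_on S"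
    and sec: "\<And>w. 0 < Re w \<Longrightarrow> m1 * Re w \<le> Im w \<Longrightarrow> Im w \<le> m2 * Re w \<Longrightarrow> w \<in> S"
    and e: "0 < e" "e < Re z" "Re z < R" and m: "m1 < m2" and z: "m1 * Re z < Im z" "Im z < m2 * Re z"
  defines "G \<equiv> \<lambda>w. g w / (w - z)"
  shows "integral {e..R} (\<lambda>t. G (Complex t (t * m1)) * Complex 1 m1) - integral {e..R} (\<lambda>t. G (Complex t (t * m2)) * Complex 1 m2)
    + \<i> * integral {R * m1..R * m2} (\<lambda>y. G (Complex R y)) - \<i> * integral {e * m1..e * m2} (\<lambda>y. G (Complex e y))
    = 2 * pi * \<i> * g z"
proof -
  let ?a = "Complex e (e * m1)" and ?b = "Complex R (R * m1)" and ?c = "Complex R (R * m2)" and ?d = "Complex e (e * m2)"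
  let ?q = "linepath ?a ?b +++ linepath ?b ?c +++ linepath ?c ?d +++ linepath ?d ?a"
  have eR: "e < R" "0 < R" using e by auto
  \<comment> \<open>For this trapezoid each orientation test factors into a product of two positive
    differences, up to a factor \<open>R\<close> or \<open>e\<close> on the vertical sides.\<close>
  have left: "0 < Im ((?b - ?a) * cnj (?b - z))" "0 < Im ((?c - ?b) * cnj (?c - z))"
    "0 < Im ((?d - ?c) * cnj (?d - z))" "0 < Im ((?a - ?d) * cnj (?a - z))"
  proof -
    have "Im ((?b - ?a) * cnj (?b - z)) = (R - e) * (Im z - m1 * Re z)" by (simp add: algebra_simps)
    then show "0 < Im ((?b - ?a) * cnj (?b - z))" using eR z by simp
    have "Im ((?c - ?b) * cnj (?c - z)) = R * (m2 - m1) * (R - Re z)" by (simp add: algebra_simps)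
    then show "0 < Im ((?c - ?b) * cnj (?c - z))" using eR e m by simp
    have "Im ((?d - ?c) * cnj (?d - z)) = (R - e) * (m2 * Re z - Im z)" by (simp add: algebra_simps)
    then show "0 < Im ((?d - ?c) * cnj (?d - z))" using eR z by simp
    have "Im ((?a - ?d) * cnj (?a - z)) = e * (m2 - m1) * (Re z - e)" by (simp add: algebra_simps)
    then show "0 < Im ((?a - ?d) * cnj (?a - z))" using e m by simp
  qed
  note notin = left[THEN winding_number_linepath_left(1)]
  have corners: "?a \<in> S" "?b \<in> S" "?c \<in> S" "?d \<in> S"
    using eR e m by (auto intro!: sec)
  then have segs: "closed_segment ?a ?b \<subseteq> S - {z}" "closed_segment ?b ?c \<subseteq> S - {z}"
    "closed_segment ?c ?d \<subseteq> S - {z}" "closed_segment ?d ?a \<subseteq> S - {z}"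
    using notin closed_segment_subset[OF _ _ S(2)] by blast+
  have cont: "continuous_on T G" if "T \<subseteq> S - {z}" for T
    unfolding G_def using that holomorphic_on_imp_continuous_on[OF g]
    by (intro continuous_intros) (auto intro: continuous_on_subset)
  have int: "G contour_integrable_on linepath ?a ?b" "G contour_integrable_on linepath ?b ?c"
    "G contour_integrable_on linepath ?c ?d" "G contour_integrable_on linepath ?d ?a"
    using segs by (auto intro!: contour_integrable_continuous_linepath cont)
  have zS: "z \<in> S" using e z by (intro sec) auto
  have "(G has_contour_integral (2 * pi * \<i> * winding_number ?q z * g z)) ?q"
    unfolding G_def
    by (rule Cauchy_integral_formula_convex_simple[OF S(2) g])
       (use zS S(1) segs in \<open>auto simp: interior_open path_image_join\<close>)
  then have "contour_integral ?q G = 2 * pi * \<i> * g z"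
    by (simp add: contour_integral_unique winding_number_quadrilateral[OF left])
  moreover have "contour_integral ?q G = contour_integral (linepath ?a ?b) G + contour_integral (linepath ?b ?c) G
      + contour_integral (linepath ?c ?d) G + contour_integral (linepath ?d ?a) G"
    using int by (simp add: contour_integrable_join)
  \<comment> \<open>The upper and the left side are run backwards, which accounts for the minus
    signs in the claim; the vertical sides contribute the factor \<open>\<i>\<close>.\<close>
  moreover have "contour_integral (linepath ?c ?d) G = - contour_integral (linepath ?d ?c) G"
    using segs by (intro contour_integral_reverse_linepath cont) auto
  moreover have "contour_integral (linepath ?d ?a) G = - contour_integral (linepath ?a ?d) G"
    using segs by (intro contour_integral_reverse_linepath cont) auto
  moreover have "contour_integral (linepath ?b ?c) G = \<i> * integral {R * m1..R * m2} (\<lambda>y. G (Complex R y))"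
    using eR m by (intro contour_integral_linepath_same_Re) auto
  moreover have "contour_integral (linepath ?a ?d) G = \<i> * integral {e * m1..e * m2} (\<lambda>y. G (Complex e y))"
    using e m by (intro contour_integral_linepath_same_Re) auto
  ultimately show ?thesis
    using contour_integral_slanted[OF eR(1), of m1 G] contour_integral_slanted[OF eR(1), of m2 G]
    by (simp add: algebra_simps)
qed

text \<open>Dominated convergence with majorant \<open>norm (H t)\<close>. It passes from the gauge
  integrals over compact pieces of a ray, as they occur in contour integrals, to the Lebesgue
  integral in \<open>ray_transform\<close>.\<close>

lemma tendsto_integral_exhaust:
  fixes h :: "real \<Rightarrow> complex"
  assumes int: "integrable lborel (\<lambda>t. indicator {0<..} t * h t)"
    and e: "\<And>n. 0 < e n" "e \<longlonglongrightarrow> 0" and R: "filterlim R at_top sequentially"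
  shows "(\<lambda>n. integral {e n..R n} h) \<longlonglongrightarrow> (\<integral>t. indicator {0<..} t * h t \<partial>lborel)"
proof -
  define H where "H t = indicator {0<..} t * h t" for t :: real
  have int': "integrable lborel H" using int by (simp add: H_def[abs_def])
  have eq: "integral {e n..R n} h = (\<integral>t. indicator {e n..R n} t *\<^sub>R H t \<partial>lborel)" for n
  proof -
    have "set_integrable lborel {e n..R n} H"
      unfolding set_integrable_def by (intro integrable_mult_indicator int') auto
    then have "(LINT t:{e n..R n}|lborel. H t) = integral {e n..R n} H"
      by (rule set_borel_integral_eq_integral)
    also have "\<dots> = integral {e n..R n} h"
      using e(1)[of n] by (intro integral_cong) (auto simp: H_def)
    finally show ?thesis by (simp add: set_lebesgue_integral_def)
  qed
  have "(\<lambda>n. \<integral>t. indicator {e n..R n} t *\<^sub>R H t \<partial>lborel) \<longlonglongrightarrow> (\<integral>t. H t \<partial>lborel)"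
  proof (rule integral_dominated_convergence)
    show "AE t in lborel. (\<lambda>n. indicator {e n..R n} t *\<^sub>R H t) \<longlonglongrightarrow> H t"
    proof (rule AE_I2)
      fix t :: real
      show "(\<lambda>n. indicator {e n..R n} t *\<^sub>R H t) \<longlonglongrightarrow> H t"
      proof (cases "0 < t")
        case True
        have "\<forall>\<^sub>F n in sequentially. e n < t" using e(2) True by (rule order_tendstoD)
        moreover have "\<forall>\<^sub>F n in sequentially. t \<le> R n" using R by (simp add: filterlim_at_top)
        ultimately have "\<forall>\<^sub>F n in sequentially. H t = indicator {e n..R n} t *\<^sub>R H t"
          by eventually_elim auto
        then show ?thesis by (rule Lim_transform_eventually[OF tendsto_const])
      qed (simp add: H_def)
    qed
    show "AE t in lborel. norm (indicator {e n..R n} t *\<^sub>R H t) \<le> norm (H t)" for n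
      by (auto simp: indicator_def)
  qed (use int' in auto)
  then show ?thesis by (simp add: eq H_def)
qed

text \<open>On the line with abscissa \<open>x\<close> the distance to \<open>z\<close> is at least
  \<open>\<bar>x - Re z\<bar>\<close>, so the Cauchy kernel leaves the integral.\<close>

lemma vertical_side_bound:
  fixes a b x B :: real
  assumes "continuous_on {a..b} (\<lambda>y. g (Complex x y))" and x: "x \<noteq> Re z" and "0 \<le> B"
    and B: "(\<integral>\<^sup>+y. indicator {a..b} y * ennreal (cmod (g (Complex x y))) \<partial>lborel) \<le> ennreal B"
  shows "cmod (integral {a..b} (\<lambda>y. g (Complex x y) / (Complex x y - z))) \<le> B / \<bar>x - Re z\<bar>"
proof -
  define h where "h y = g (Complex x y) / (Complex x y - z)" for y
  have "continuous_on {a..b} h"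
    unfolding h_def using x assms(1) by (intro continuous_intros) (auto simp: complex_eq_iff Complex_eq intro!: continuous_intros)
  then have int: "set_integrable lborel {a..b} h" by (rule borel_integrable_atLeastAtMost')
  have "ennreal (cmod (integral {a..b} h)) = ennreal (norm (\<integral>y. indicator {a..b} y *\<^sub>R h y \<partial>lborel))"
    using set_borel_integral_eq_integral(2)[OF int] by (simp add: set_lebesgue_integral_def)
  also have "\<dots> \<le> (\<integral>\<^sup>+y. norm (indicator {a..b} y *\<^sub>R h y) \<partial>lborel)"
    using int by (intro integral_norm_bound_ennreal) (simp add: set_integrable_def)
  also have "\<dots> \<le> (\<integral>\<^sup>+y. ennreal (1 / \<bar>x - Re z\<bar>) * (indicator {a..b} y * ennreal (cmod (g (Complex x y)))) \<partial>lborel)"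
  proof (rule nn_integral_mono)
    fix y
    have "cmod (h y) \<le> 1 / \<bar>x - Re z\<bar> * cmod (g (Complex x y))"
      using abs_Re_le_cmod[of "Complex x y - z"] x by (auto simp: h_def norm_divide intro!: divide_left_mono mult_pos_pos)
    then show "ennreal (norm (indicator {a..b} y *\<^sub>R h y)) \<le> ennreal (1 / \<bar>x - Re z\<bar>) * (indicator {a..b} y * ennreal (cmod (g (Complex x y))))"
      by (auto simp: indicator_def ennreal_mult[symmetric] intro!: ennreal_leI)
  qed
  \<comment> \<open>The integrand is rewritten as the norm of the cut-off function, whose
    measurability follows from the continuity of \<open>g\<close> on the segment.\<close>
  also have "\<dots> = (\<integral>\<^sup>+y. ennreal (1 / \<bar>x - Re z\<bar>) * ennreal (norm (indicator {a..b} y *\<^sub>R g (Complex x y))) \<partial>lborel)"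
    by (intro nn_integral_cong) (auto simp: indicator_def)
  also have "\<dots> = ennreal (1 / \<bar>x - Re z\<bar>) * (\<integral>\<^sup>+y. ennreal (norm (indicator {a..b} y *\<^sub>R g (Complex x y))) \<partial>lborel)"
  proof -
    have [measurable]: "(\<lambda>y. indicator {a..b} y *\<^sub>R g (Complex x y)) \<in> borel_measurable borel"
      using assms(1) by (intro borel_measurable_continuous_on_indicator) auto
    show ?thesis by (intro nn_integral_cmult) measurable
  qed
  also have "(\<integral>\<^sup>+y. ennreal (norm (indicator {a..b} y *\<^sub>R g (Complex x y))) \<partial>lborel)
      = (\<integral>\<^sup>+y. indicator {a..b} y * ennreal (cmod (g (Complex x y))) \<partial>lborel)"
    by (intro nn_integral_cong) (auto simp: indicator_def)
  also have "ennreal (1 / \<bar>x - Re z\<bar>) * \<dots> \<le> ennreal (1 / \<bar>x - Re z\<bar>) * ennreal B"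
    by (intro mult_left_mono B) auto
  also have "\<dots> = ennreal (B / \<bar>x - Re z\<bar>)" using \<open>0 \<le> B\<close> by (simp add: ennreal_mult[symmetric])
  finally show ?thesis using \<open>0 \<le> B\<close> by (simp add: h_def[abs_def])
qed

text \<open>Let the trapezoids of \<open>Cauchy_formula_sector\<close> exhaust the sector through
  abscissae provided by \<open>V\<close>. The slanted sides converge to the two ray transforms. A
  vertical side is at most \<open>K * sqrt x / \<bar>x - Re z\<bar>\<close>, which tends to 0 both
  for \<open>x\<close> tending to 0 and for \<open>x\<close> tending to infinity.\<close>

lemma ray_transform_jump:
  fixes m1 m2 K :: real and z :: complex
  assumes S: "open S" "convex S" and g: "g holomorphic_on S" "g \<in> borel_measurable borel"
    and sec: "\<And>w. 0 < Re w \<Longrightarrow> m1 * Re w \<le> Im w \<Longrightarrow> Im w \<le> m2 * Re w \<Longrightarrow> w \<in> S"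
    and m: "m1 < m2" and ri: "ray_integrable m1 g" "ray_integrable m2 g" and K: "0 \<le> K"
    and V: "\<And>X. 0 < X \<Longrightarrow> \<exists>x\<in>{X..2*X}. (\<integral>\<^sup>+y. indicator {x * m1..x * m2} y * ennreal (cmod (g (Complex x y))) \<partial>lborel) \<le> ennreal (K * sqrt x)"
    and z: "0 < Re z" "m1 * Re z < Im z" "Im z < m2 * Re z"
  shows "ray_transform m1 g z = g z + ray_transform m2 g z"
proof -
  define P where "P x \<longleftrightarrow> (\<integral>\<^sup>+y. indicator {x * m1..x * m2} y * ennreal (cmod (g (Complex x y))) \<partial>lborel) \<le> ennreal (K * sqrt x)" for x
  \<comment> \<open>One good abscissa is picked at each of the scales \<open>1 / Suc n\<close> and
    \<open>Suc n\<close>.\<close>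
  have "\<forall>n. \<exists>x. 1 / real (Suc n) \<le> x \<and> x \<le> 2 * (1 / real (Suc n)) \<and> P x"
    using V[of "1 / real (Suc _)"] by (force simp: P_def)
  then obtain e where e: "\<And>n. 1 / real (Suc n) \<le> e n" "\<And>n. e n \<le> 2 * (1 / real (Suc n))" "\<And>n. P (e n)" by metis
  have "\<forall>n. \<exists>x. real (Suc n) \<le> x \<and> x \<le> 2 * real (Suc n) \<and> P x"
    using V[of "real (Suc _)"] by (force simp: P_def)
  then obtain R where R: "\<And>n. real (Suc n) \<le> R n" "\<And>n. P (R n)" by metis
  have e0: "0 < e n" for n using e(1)[of n] by (smt (verit) divide_pos_pos of_nat_0_less_iff zero_less_Suc)
  have elim: "e \<longlonglongrightarrow> 0"
  proof (rule tendsto_sandwich[where f = "\<lambda>_. 0" and h = "\<lambda>n. 2 * (1 / real (Suc n))"])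
    show "(\<lambda>n. 2 * (1 / real (Suc n))) \<longlonglongrightarrow> 0" by real_asymp
    show "\<forall>\<^sub>F n in sequentially. 0 \<le> e n" using e0 by (simp add: less_imp_le)
    show "\<forall>\<^sub>F n in sequentially. e n \<le> 2 * (1 / real (Suc n))" using e(2) by simp
  qed simp
  have Rlim: "filterlim R at_top sequentially"
    by (rule filterlim_at_top_mono[where f = "\<lambda>n. real (Suc n)"]) (use R in \<open>auto, real_asymp\<close>)
  define G where "G w = g w / (w - z)" for w
  define V where "V x = integral {x * m1..x * m2} (\<lambda>y. G (Complex x y))" for x
  define D where "D n = integral {e n..R n} (\<lambda>t. G (Complex t (t * m1)) * Complex 1 m1) - integral {e n..R n} (\<lambda>t. G (Complex t (t * m2)) * Complex 1 m2)" for n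
  have int: "integrable lborel (\<lambda>t. indicator {0<..} t * (G (Complex t (t * m)) * Complex 1 m))"
    and eq: "(\<integral>t. indicator {0<..} t * (G (Complex t (t * m)) * Complex 1 m) \<partial>lborel) = 2 * pi * \<i> * ray_transform m g z"
    if "m = m1 \<or> m = m2" for m
  proof -
    have *: "(\<lambda>t. indicator {0<..} t * (G (Complex t (t * m)) * Complex 1 m))
      = (\<lambda>t. indicator {0<..} t * g (Complex t (t * m)) * Complex 1 m / (Complex t (t * m) - z))"
      by (simp add: G_def fun_eq_iff)
    show "integrable lborel (\<lambda>t. indicator {0<..} t * (G (Complex t (t * m)) * Complex 1 m))"
      unfolding * using that z ri g(2) by (intro ray_transform_integrable) auto
    show "(\<integral>t. indicator {0<..} t * (G (Complex t (t * m)) * Complex 1 m) \<partial>lborel) = 2 * pi * \<i> * ray_transform m g z"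
      unfolding * ray_transform_def by simp
  qed
  have "D \<longlonglongrightarrow> 2 * pi * \<i> * ray_transform m1 g z - 2 * pi * \<i> * ray_transform m2 g z"
    unfolding D_def eq[of m1, OF disjI1, OF refl, symmetric] eq[of m2, OF disjI2, OF refl, symmetric]
    by (intro tendsto_diff tendsto_integral_exhaust int e0 elim Rlim) simp_all
  moreover have "D \<longlonglongrightarrow> 2 * pi * \<i> * g z"
  proof -
    have bound: "cmod (V x) \<le> K * sqrt x / \<bar>x - Re z\<bar>" if "P x" "0 < x" "x \<noteq> Re z" for x
      unfolding V_def G_def
    proof (rule vertical_side_bound)
      have sub: "(\<lambda>y. Complex x y) ` {x * m1..x * m2} \<subseteq> S"
        using that by (auto intro!: sec simp: mult.commute)
      have "continuous_on {x * m1..x * m2} (\<lambda>y. Complex x y)" unfolding Complex_eq by (intro continuous_intros)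
      then show "continuous_on {x * m1..x * m2} (\<lambda>y. g (Complex x y))"
        by (rule continuous_on_compose2[OF holomorphic_on_imp_continuous_on[OF g(1)] _ sub])
    qed (use that K in \<open>auto simp: P_def\<close>)
    have evR: "\<forall>\<^sub>F n in sequentially. Re z < R n" using Rlim by (simp add: filterlim_at_top_dense)
    have eve: "\<forall>\<^sub>F n in sequentially. e n < Re z" using elim z by (simp add: order_tendstoD)
    have VR: "(\<lambda>n. V (R n)) \<longlonglongrightarrow> 0"
    proof (rule Lim_null_comparison)
      show "\<forall>\<^sub>F n in sequentially. norm (V (R n)) \<le> K * sqrt (R n) / \<bar>R n - Re z\<bar>"
        using evR by eventually_elim (intro bound, use R z in auto)
      have "((\<lambda>x. K * sqrt x / \<bar>x - Re z\<bar>) \<longlongrightarrow> 0) at_top" by real_asymp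
      then show "(\<lambda>n. K * sqrt (R n) / \<bar>R n - Re z\<bar>) \<longlonglongrightarrow> 0" using Rlim by (rule filterlim_compose)
    qed
    have Ve: "(\<lambda>n. V (e n)) \<longlonglongrightarrow> 0"
    proof (rule Lim_null_comparison)
      show "\<forall>\<^sub>F n in sequentially. norm (V (e n)) \<le> K * sqrt (e n) / \<bar>e n - Re z\<bar>"
        using eve by eventually_elim (intro bound, use e e0 in auto)
      have "(\<lambda>n. K * sqrt (e n) / \<bar>e n - Re z\<bar>) \<longlonglongrightarrow> K * sqrt 0 / \<bar>0 - Re z\<bar>"
        using z by (intro tendsto_intros elim) auto
      then show "(\<lambda>n. K * sqrt (e n) / \<bar>e n - Re z\<bar>) \<longlonglongrightarrow> 0" by simp
    qed
    \<comment> \<open>The sector formula applies only once \<open>z\<close> lies between the two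
      vertical sides.\<close>
    have "\<forall>\<^sub>F n in sequentially. 2 * pi * \<i> * g z - \<i> * V (R n) + \<i> * V (e n) = D n"
      using evR eve
    proof eventually_elim
      case (elim n)
      show ?case
        using Cauchy_formula_sector[OF S g(1) sec e0 elim(2,1) m z(2,3)]
        by (simp add: D_def V_def G_def algebra_simps)
    qed
    moreover have "(\<lambda>n. 2 * pi * \<i> * g z - \<i> * V (R n) + \<i> * V (e n)) \<longlonglongrightarrow> 2 * pi * \<i> * g z - \<i> * 0 + \<i> * 0"
      by (intro tendsto_intros VR Ve)
    ultimately show ?thesis by (simp add: Lim_transform_eventually)
  qed
  ultimately have "2 * pi * \<i> * ray_transform m1 g z - 2 * pi * \<i> * ray_transform m2 g z = 2 * pi * \<i> * g z"
    by (rule LIMSEQ_unique)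
  then have "2 * pi * \<i> * ray_transform m1 g z = 2 * pi * \<i> * (g z + ray_transform m2 g z)"
    by (simp add: algebra_simps)
  then show ?thesis by simp
qed

section \<open>Splitting functions on the quadrant\<close>

text \<open>On the ray, \<open>cmod g\<close> equals \<open>t powr s * u t\<close> up to the
  constant \<open>w powr s\<close>, where \<open>u\<close> is the modulus of \<open>f\<close> there.
  This is the integrand of the Hardy inequalities, whose hypothesis is \<open>N\<close>.\<close>

lemma ray_transform_powr_weight:
  fixes p s m :: real and f :: "complex \<Rightarrow> complex"
  defines "g \<equiv> \<lambda>z. f z * z powr s"
  assumes p: "1 < p" and s: "s = 2 / p - 1 / 2" and f[measurable]: "f \<in> borel_measurable borel"
    and g[measurable]: "g \<in> borel_measurable borel"
    and N: "(\<integral>\<^sup>+t. indicator {0<..} t * (ennreal t * ennreal (cmod (f (Complex t (t * m))) powr p)) \<partial>lborel) < \<infinity>"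
  shows "ray_integrable m g"
    and "\<lbrakk>0 \<notin> S; 0 \<le> C; \<And>z t. z \<in> S \<Longrightarrow> 0 < t \<Longrightarrow> t + cmod z \<le> C * cmod (Complex t (t * m) - z)\<rbrakk>
      \<Longrightarrow> (\<integral>\<^sup>+z. indicator S z * ennreal (cmod (ray_transform m g z / z powr s) powr p) \<partial>lborel) < \<infinity>"
proof -
  define u where "u t = cmod (f (Complex t (t * m)))" for t
  define w where "w = cmod (Complex 1 m)"
  define I where "I r = (\<integral>\<^sup>+t. indicator {0<..} t * ennreal (t powr s * u t / (t + r)) \<partial>lborel)" for r
  have u: "u \<in> borel_measurable borel" "\<And>t. 0 \<le> u t" by (auto simp: u_def[abs_def])
  have "(\<integral>\<^sup>+t. indicator {0<..} t * ennreal (t * u t powr p) \<partial>lborel)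
    = (\<integral>\<^sup>+t. indicator {0<..} t * (ennreal t * ennreal (cmod (f (Complex t (t * m))) powr p)) \<partial>lborel)"
    by (intro nn_integral_cong) (auto simp: u_def indicator_def ennreal_mult)
  with N have N': "(\<integral>\<^sup>+t. indicator {0<..} t * ennreal (t * u t powr p) \<partial>lborel) < \<infinity>" by simp
  have norm_g: "cmod (g (Complex t (t * m))) = w powr s * (t powr s * u t)" if "0 < t" for t
  proof -
    have "Complex t (t * m) = of_real t * Complex 1 m" by (simp add: complex_eq_iff)
    then have "cmod (Complex t (t * m)) = t * w" using that by (simp add: w_def norm_mult)
    then show ?thesis using that by (simp add: g_def u_def norm_mult norm_powr_real_powr' powr_mult w_def)
  qed
  have I: "(\<integral>\<^sup>+t. indicator {0<..} t * ennreal (cmod (g (Complex t (t * m))) / (t + r)) \<partial>lborel) = ennreal (w powr s) * I r"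
    if "0 < r" for r
  proof -
    have [measurable]: "u \<in> borel_measurable borel" by (rule u)
    have "(\<integral>\<^sup>+t. indicator {0<..} t * ennreal (cmod (g (Complex t (t * m))) / (t + r)) \<partial>lborel)
      = (\<integral>\<^sup>+t. ennreal (w powr s) * (indicator {0<..} t * ennreal (t powr s * u t / (t + r))) \<partial>lborel)"
      using that u(2) by (intro nn_integral_cong) (auto simp: indicator_def norm_g ennreal_mult[symmetric])
    also have "\<dots> = ennreal (w powr s) * I r" unfolding I_def by (rule nn_integral_cmult) measurable
    finally show ?thesis .
  qed
  show ri: "ray_integrable m g"
    unfolding ray_integrable_def
    using hardy_pointwise(1)[OF p s _ u N'] by (auto simp: I I_def ennreal_mult_less_top)
  assume S: "0 \<notin> S" "0 \<le> C" and sep: "\<And>z t. z \<in> S \<Longrightarrow> 0 < t \<Longrightarrow> t + cmod z \<le> C * cmod (Complex t (t * m) - z)"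
  show "(\<integral>\<^sup>+z. indicator S z * ennreal (cmod (ray_transform m g z / z powr s) powr p) \<partial>lborel) < \<infinity>"
  proof (rule hardy_nn_integral[OF p s u N' S(1)])
    show "0 \<le> C * w * w powr s" using S by (simp add: w_def)
    show "cmod (ray_transform m g z) \<le> C * w * w powr s * enn2real (\<integral>\<^sup>+t. indicator {0<..} t * ennreal (t powr s * u t / (t + cmod z)) \<partial>lborel)" if "z \<in> S" for z
    proof -
      have "z \<noteq> 0" using S that by auto
      then show ?thesis
        using ray_transform_bound[OF g ri \<open>z \<noteq> 0\<close> S(2) sep[OF that]] I[of "cmod z"]
        by (simp add: I_def w_def enn2real_mult mult.assoc)
    qed
  qed
qed

text \<open>On the segment, \<open>cmod z\<close> lies between \<open>x\<close> and
  \<open>4 * x\<close>, so the weight is of size \<open>x powr s\<close>;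
  \<open>powr_tangent_le\<close> then passes from the integral of the \<open>p\<close>-th power to
  that of the modulus.\<close>

lemma vertical_powr_weight_bound:
  fixes p s x a b C :: real and f :: "complex \<Rightarrow> complex"
  assumes p: "1 < p" and s: "s = 2 / p - 1 / 2" and f[measurable]: "f \<in> borel_measurable borel"
    and x: "0 < x" and ab: "0 \<le> a" "a \<le> b" "b \<le> 3" and C: "0 \<le> C"
    and le: "(\<integral>\<^sup>+y. ennreal (cmod (f (Complex x y)) powr p) \<partial>lborel) \<le> ennreal (C / x)"
  shows "(\<integral>\<^sup>+y. indicator {x * a..x * b} y * ennreal (cmod (f (Complex x y) * Complex x y powr s)) \<partial>lborel)
    \<le> ennreal (4 powr (3/2) * (3 + C) * sqrt x)"
proof -
  \<comment> \<open>The typical size of \<open>f\<close>: an integral \<open>C / x\<close> of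
    \<open>cmod f powr p\<close> over a length of order \<open>x\<close> suggests
    \<open>x powr - (2 / p)\<close>. With it both terms are of order \<open>sqrt x\<close>.\<close>
  define l where "l = x powr - (2 / p)"
  define A where "A = 4 powr (3/2) * x powr s"
  have l: "0 < l" "0 \<le> A" using x by (auto simp: l_def A_def)
  have weight: "cmod (Complex x y powr s) \<le> A" if "y \<in> {x * a..x * b}" for y
  proof -
    define v where "v = cmod (Complex x y) / x"
    have "0 \<le> y" "y \<le> x * 3"
      using that mult_nonneg_nonneg[of x a] mult_left_mono[of b 3 x] x ab
      unfolding atLeastAtMost_iff by linarith+
    then have v: "1 \<le> v" "v \<le> 4"
      using x complex_Re_le_cmod[of "Complex x y"] cmod_le[of "Complex x y"] by (auto simp: v_def field_simps)
    \<comment> \<open>For large \<open>p\<close> the exponent \<open>s\<close> is negative; as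
      \<open>1 \<le> v\<close>, raising it to 3/2 covers all cases.\<close>
    have "s \<le> 3/2" using p by (simp add: s field_simps)
    then have "v powr s \<le> v powr (3/2)" using v by (intro powr_mono) auto
    also have "\<dots> \<le> 4 powr (3/2)" using v by (intro powr_mono2) auto
    finally have "v powr s \<le> 4 powr (3/2)" .
    moreover have "cmod (Complex x y powr s) = v powr s * x powr s"
      using x v by (simp add: norm_powr_real_powr' v_def powr_divide)
    ultimately show ?thesis by (simp add: A_def mult_right_mono)
  qed
  have "(\<integral>\<^sup>+y. indicator {x * a..x * b} y * ennreal (cmod (f (Complex x y) * Complex x y powr s)) \<partial>lborel)
    \<le> (\<integral>\<^sup>+y. ennreal (A * l) * indicator {x * a..x * b} y + ennreal (A * l powr (1 - p)) * ennreal (cmod (f (Complex x y)) powr p) \<partial>lborel)"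
  proof (rule nn_integral_mono)
    fix y
    show "indicator {x * a..x * b} y * ennreal (cmod (f (Complex x y) * Complex x y powr s))
      \<le> ennreal (A * l) * indicator {x * a..x * b} y + ennreal (A * l powr (1 - p)) * ennreal (cmod (f (Complex x y)) powr p)"
    proof (cases "y \<in> {x * a..x * b}")
      case True
      let ?u = "cmod (f (Complex x y))"
      have "cmod (f (Complex x y) * Complex x y powr s) \<le> (l + l powr (1 - p) * ?u powr p) * A"
        unfolding norm_mult using True l p by (intro mult_mono weight powr_tangent_le) auto
      also have "\<dots> = A * l + A * l powr (1 - p) * ?u powr p" by (simp add: algebra_simps)
      finally show ?thesis
        using True l by (simp add: ennreal_mult[symmetric] ennreal_plus[symmetric] ennreal_leI del: ennreal_plus)
    qed simp
  qed
  also have "\<dots> = ennreal (A * l) * emeasure lborel {x * a..x * b} + ennreal (A * l powr (1 - p)) * (\<integral>\<^sup>+y. ennreal (cmod (f (Complex x y)) powr p) \<partial>lborel)"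
    by (simp add: nn_integral_add nn_integral_cmult)
  also have "\<dots> \<le> ennreal (A * l) * ennreal (3 * x) + ennreal (A * l powr (1 - p)) * ennreal (C / x)"
  proof (intro add_mono mult_left_mono le)
    have "x * b - x * a \<le> 3 * x"
      using x ab mult_left_mono[of "b - a" 3 x] by (simp add: algebra_simps)
    then show "emeasure lborel {x * a..x * b} \<le> ennreal (3 * x)"
      using x ab by (simp add: mult_left_mono ennreal_leI)
  qed auto
  also have "\<dots> = ennreal (A * l * (3 * x) + A * l powr (1 - p) * (C / x))"
    using l x C by (simp add: ennreal_mult[symmetric] ennreal_plus[symmetric] del: ennreal_plus)
  also have "A * l * (3 * x) + A * l powr (1 - p) * (C / x) = 4 powr (3/2) * (3 + C) * sqrt x"
  proof -
    have e1: "x powr s * l * x = sqrt x"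
      using x powr_add[of x "s - 2/p" 1] powr_add[of x s "-(2/p)"]
      by (simp add: l_def s powr_half_sqrt[symmetric])
    have "l powr (1 - p) = l * x\<^sup>2"
    proof -
      have "- (2/p) * (1 - p) = - (2/p) + 2" using p by (simp add: field_simps)
      then have "l powr (1 - p) = x powr (- (2/p) + 2)" by (simp only: l_def powr_powr)
      also have "\<dots> = l * x\<^sup>2" using x by (subst powr_add) (simp add: l_def)
      finally show ?thesis .
    qed
    then have e2: "x powr s * l powr (1 - p) * (C / x) = C * sqrt x"
      using x by (simp add: e1[symmetric] power2_eq_square)
    have "A * l * (3 * x) + A * l powr (1 - p) * (C / x)
      = 4 powr (3/2) * (3 * (x powr s * l * x) + x powr s * l powr (1 - p) * (C / x))"
      by (simp add: A_def algebra_simps)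
    then show ?thesis unfolding e1 e2 by (simp add: algebra_simps)
  qed
  finally show ?thesis .
qed

text \<open>A holomorphic function on an open set, cut off outside it, is Borel; so integrability
  reduces to a finite nonnegative integral. \<open>restrict\<close> supplies the extensional
  representative.\<close>

lemma bergman_spaceI:
  assumes "open S" and hol: "f holomorphic_on S"
    and fin: "(\<integral>\<^sup>+z. indicator S z * ennreal (cmod (f z) powr p) \<partial>lborel) < \<infinity>"
  shows "restrict f S \<in> bergman_space p S"
proof -
  have [measurable]: "(\<lambda>z. indicator S z *\<^sub>R f z) \<in> borel_measurable borel"
    using assms by (intro borel_measurable_continuous_on_indicator holomorphic_on_imp_continuous_on) auto
  have eq: "(\<lambda>z. indicator S z *\<^sub>R (cmod (restrict f S z) powr p)) = (\<lambda>z. cmod (indicator S z *\<^sub>R f z) powr p)"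
    by (auto simp: indicator_def fun_eq_iff)
  have "integrable lborel (\<lambda>z. cmod (indicator S z *\<^sub>R f z) powr p)"
  proof (rule integrableI_bounded)
    have "(\<integral>\<^sup>+z. ennreal (norm (cmod (indicator S z *\<^sub>R f z) powr p)) \<partial>lborel)
      = (\<integral>\<^sup>+z. indicator S z * ennreal (cmod (f z) powr p) \<partial>lborel)"
      by (intro nn_integral_cong) (auto simp: indicator_def)
    with fin show "(\<integral>\<^sup>+z. ennreal (norm (cmod (indicator S z *\<^sub>R f z) powr p)) \<partial>lborel) < \<infinity>" by simp
  qed measurable
  moreover have "restrict f S holomorphic_on S" using hol by (rule holomorphic_transform) auto
  moreover have "set_integrable lborel S (\<lambda>z. cmod (restrict f S z) powr p)"
    unfolding set_integrable_def eq by fact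
  ultimately show ?thesis by (simp add: bergman_space_def del: restrict_apply)
qed

lemma bergman_spaceD:
  assumes "f \<in> bergman_space p S"
  shows "f \<in> extensional S" "f holomorphic_on S"
    and "(\<integral>\<^sup>+z. indicator S z * ennreal (cmod (f z) powr p) \<partial>lborel) < \<infinity>"
proof -
  show "f \<in> extensional S" "f holomorphic_on S" using assms by (auto simp: bergman_space_def)
  have "integrable lborel (\<lambda>z. indicator S z *\<^sub>R (cmod (f z) powr p))"
    using assms by (simp add: bergman_space_def set_integrable_def)
  then have "(\<integral>\<^sup>+z. ennreal (norm (indicator S z *\<^sub>R (cmod (f z) powr p))) \<partial>lborel) < \<infinity>"
    by (simp add: integrable_iff_bounded)
  moreover have "(\<integral>\<^sup>+z. ennreal (norm (indicator S z *\<^sub>R (cmod (f z) powr p))) \<partial>lborel)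
      = (\<integral>\<^sup>+z. indicator S z * ennreal (cmod (f z) powr p) \<partial>lborel)"
    by (intro nn_integral_cong) (auto simp: indicator_def)
  ultimately show "(\<integral>\<^sup>+z. indicator S z * ennreal (cmod (f z) powr p) \<partial>lborel) < \<infinity>" by simp
qed

lemma powr_add_le:
  fixes a b p :: real
  assumes "0 \<le> a" "0 \<le> b" "0 \<le> p"
  shows "(a + b) powr p \<le> 2 powr p * (a powr p + b powr p)"
proof -
  have "(a + b) powr p \<le> (2 * max a b) powr p" using assms by (intro powr_mono2) auto
  also have "\<dots> = 2 powr p * max a b powr p" using assms by (simp add: powr_mult)
  also have "max a b powr p \<le> a powr p + b powr p" by (auto simp: max_def)
  finally show ?thesis by (simp add: mult_left_mono)
qed

text \<open>Serves both inclusions. For the decomposition, \<open>\<alpha>\<close> majorises the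
  given function, and \<open>\<beta>\<close> and \<open>\<gamma>\<close> the Cauchy integrals on the
  two sides of the diagonal, so \<open>b\<close> may be chosen according to the side. For the sum of
  two functions, \<open>\<gamma>\<close> is 0.\<close>

lemma nn_integral_powr_add_finite:
  fixes \<alpha> \<beta> \<gamma> :: "complex \<Rightarrow> ennreal" and p :: real
  assumes [measurable]: "\<alpha> \<in> borel_measurable borel" "\<beta> \<in> borel_measurable borel" "\<gamma> \<in> borel_measurable borel"
    and p: "0 \<le> p"
    and fin: "(\<integral>\<^sup>+z. \<alpha> z \<partial>lborel) < \<infinity>" "(\<integral>\<^sup>+z. \<beta> z \<partial>lborel) < \<infinity>" "(\<integral>\<^sup>+z. \<gamma> z \<partial>lborel) < \<infinity>"
    and le: "\<And>z. z \<in> S \<Longrightarrow> \<exists>a\<ge>0. \<exists>b\<ge>0. F z \<le> a + b \<and> ennreal (a powr p) \<le> \<alpha> z \<and> ennreal (b powr p) \<le> \<beta> z + \<gamma> z"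
    and F: "\<And>z. 0 \<le> F z"
  shows "(\<integral>\<^sup>+z. indicator S z * ennreal (F z powr p) \<partial>lborel) < \<infinity>"
proof -
  have "(\<integral>\<^sup>+z. indicator S z * ennreal (F z powr p) \<partial>lborel) \<le> (\<integral>\<^sup>+z. ennreal (2 powr p) * (\<alpha> z + (\<beta> z + \<gamma> z)) \<partial>lborel)"
  proof (rule nn_integral_mono)
    fix z
    show "indicator S z * ennreal (F z powr p) \<le> ennreal (2 powr p) * (\<alpha> z + (\<beta> z + \<gamma> z))"
    proof (cases "z \<in> S")
      case True
      then obtain a b where ab: "0 \<le> a" "0 \<le> b" "F z \<le> a + b" "ennreal (a powr p) \<le> \<alpha> z" "ennreal (b powr p) \<le> \<beta> z + \<gamma> z"
        using le by blast
      have "F z powr p \<le> (a + b) powr p" using ab F p by (intro powr_mono2) auto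
      also have "\<dots> \<le> 2 powr p * (a powr p + b powr p)" using ab p by (intro powr_add_le) auto
      finally have "ennreal (F z powr p) \<le> ennreal (2 powr p * (a powr p + b powr p))" by (rule ennreal_leI)
      also have "\<dots> = ennreal (2 powr p) * (ennreal (a powr p) + ennreal (b powr p))" by (simp add: ennreal_mult)
      also have "\<dots> \<le> ennreal (2 powr p) * (\<alpha> z + (\<beta> z + \<gamma> z))"
        using ab by (intro mult_left_mono add_mono) auto
      finally show ?thesis using True by simp
    qed simp
  qed
  also have "\<dots> = ennreal (2 powr p) * ((\<integral>\<^sup>+z. \<alpha> z \<partial>lborel) + ((\<integral>\<^sup>+z. \<beta> z \<partial>lborel) + (\<integral>\<^sup>+z. \<gamma> z \<partial>lborel)))"
    by (simp add: nn_integral_add nn_integral_cmult)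
  also have "\<dots> < \<infinity>" using fin by (simp add: ennreal_mult_less_top)
  finally show ?thesis .
qed

lemma open_half_planes: "open upper_half_plane" "open right_half_plane" "open first_quadrant"
proof -
  show *: "open upper_half_plane" "open right_half_plane"
    unfolding upper_half_plane_def right_half_plane_def
    by (intro open_Collect_less continuous_intros)+
  show "open first_quadrant" unfolding first_quadrant_def by (intro open_Int *)
qed

lemma convex_first_quadrant: "convex first_quadrant"
  unfolding first_quadrant_def right_half_plane_def upper_half_plane_def
  by (intro convex_Int convex_halfspace_Re_gt convex_halfspace_Im_gt)

section \<open>The inclusion of the sum in the Bergman space of the quadrant\<close>

lemma sum_on_bergman_space_subset:
  assumes p: "0 \<le> p"
  shows "sum_on first_quadrant (bergman_space p upper_half_plane) (bergman_space p right_half_plane)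
    \<subseteq> bergman_space p first_quadrant"
proof -
  have "restrict (\<lambda>z. f1 z + f2 z) first_quadrant \<in> bergman_space p first_quadrant"
    if f: "f1 \<in> bergman_space p upper_half_plane" "f2 \<in> bergman_space p right_half_plane" for f1 f2
  proof (rule bergman_spaceI[OF open_half_planes(3)])
    note D1 = bergman_spaceD[OF f(1)] and D2 = bergman_spaceD[OF f(2)]
    show "(\<lambda>z. f1 z + f2 z) holomorphic_on first_quadrant"
      using D1(2) D2(2) by (intro holomorphic_intros) (auto simp: first_quadrant_def elim: holomorphic_on_subset)
    have meas: "(\<lambda>z. indicator S z * ennreal (cmod (h z) powr p)) \<in> borel_measurable borel"
      if "open S" "h holomorphic_on S" for S and h :: "complex \<Rightarrow> complex"
    proof -
      have [measurable]: "(\<lambda>z. indicator S z *\<^sub>R h z) \<in> borel_measurable borel" "S \<in> sets borel"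
        using that by (auto intro!: borel_measurable_continuous_on_indicator holomorphic_on_imp_continuous_on)
      have "(\<lambda>z. indicator S z * ennreal (cmod (indicator S z *\<^sub>R h z) powr p)) \<in> borel_measurable borel" by measurable
      also have "(\<lambda>z. indicator S z * ennreal (cmod (indicator S z *\<^sub>R h z) powr p)) = (\<lambda>z. indicator S z * ennreal (cmod (h z) powr p))"
        by (auto simp: indicator_def fun_eq_iff)
      finally show ?thesis .
    qed
    show "(\<integral>\<^sup>+z. indicator first_quadrant z * ennreal (cmod (f1 z + f2 z) powr p) \<partial>lborel) < \<infinity>"
    proof (rule nn_integral_powr_add_finite[OF meas[OF open_half_planes(1) D1(2)] meas[OF open_half_planes(2) D2(2)] _ p D1(3) D2(3)])
      show "(\<lambda>z. 0) \<in> borel_measurable borel" "(\<integral>\<^sup>+z. 0 \<partial>lborel) < (\<infinity>::ennreal)" by auto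
      show "\<exists>a\<ge>0. \<exists>b\<ge>0. cmod (f1 z + f2 z) \<le> a + b \<and>
          ennreal (a powr p) \<le> indicator upper_half_plane z * ennreal (cmod (f1 z) powr p) \<and>
          ennreal (b powr p) \<le> indicator right_half_plane z * ennreal (cmod (f2 z) powr p) + 0" if "z \<in> first_quadrant" for z
        using that by (intro exI[of _ "cmod (f1 z)"] exI[of _ "cmod (f2 z)"] conjI)
          (auto simp: first_quadrant_def norm_triangle_ineq)
    qed auto
  qed
  then show ?thesis by (auto simp: sum_on_def)
qed

section \<open>The decomposition of a Bergman function on the quadrant\<close>

lemma quadrant_decomposition:
  assumes p: "1 < p" and f: "f \<in> bergman_space p first_quadrant"
  shows "\<exists>f1 \<in> bergman_space p upper_half_plane. \<exists>f2 \<in> bergman_space p right_half_plane.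
    \<forall>z\<in>first_quadrant. f z = f1 z + f2 z"
proof -
  note D = bergman_spaceD[OF f]
  define s where "s = 2 / p - 1 / 2"
  \<comment> \<open>Off the quadrant \<open>f\<close> is \<open>undefined\<close>; the extension by
    0 is Borel on the whole plane.\<close>
  define h where "h z = indicator first_quadrant z *\<^sub>R f z" for z
  define g where "g z = h z * z powr s" for z
  define \<phi> where "\<phi> z = ennreal (cmod (h z) powr p)" for z
  \<comment> \<open>The cut of the principal branch, the nonpositive real axis, misses both half
    planes, so one branch serves everywhere.\<close>
  have hol_powr: "(\<lambda>z. z powr s) holomorphic_on S" if "S \<subseteq> upper_half_plane \<union> right_half_plane" for S
    using that by (intro holomorphic_intros) (auto simp: upper_half_plane_def right_half_plane_def elim!: nonpos_Reals_cases)
  have g_hol: "g holomorphic_on first_quadrant"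
  proof -
    have "(\<lambda>z. f z * z powr s) holomorphic_on first_quadrant"
      by (intro holomorphic_on_mult D hol_powr) (auto simp: first_quadrant_def)
    then show ?thesis by (rule holomorphic_transform) (auto simp: g_def h_def)
  qed
  have h_meas[measurable]: "h \<in> borel_measurable borel"
    unfolding h_def using D(2) open_half_planes(3)
    by (intro borel_measurable_continuous_on_indicator holomorphic_on_imp_continuous_on) auto
  have g_meas[measurable]: "g \<in> borel_measurable borel"
  proof -
    have "(\<lambda>z. indicator first_quadrant z *\<^sub>R g z) \<in> borel_measurable borel"
      using g_hol open_half_planes(3)
      by (intro borel_measurable_continuous_on_indicator holomorphic_on_imp_continuous_on) auto
    also have "(\<lambda>z. indicator first_quadrant z *\<^sub>R g z) = g" by (auto simp: g_def h_def fun_eq_iff indicator_def)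
    finally show ?thesis .
  qed
  have \<phi>_meas[measurable]: "\<phi> \<in> borel_measurable borel" unfolding \<phi>_def by measurable
  have \<phi>_fin: "(\<integral>\<^sup>+z. \<phi> z \<partial>lborel) < \<infinity>"
  proof -
    have "(\<integral>\<^sup>+z. \<phi> z \<partial>lborel) = (\<integral>\<^sup>+z. indicator first_quadrant z * ennreal (cmod (f z) powr p) \<partial>lborel)"
      by (intro nn_integral_cong) (auto simp: \<phi>_def h_def indicator_def)
    then show ?thesis using D(3) by simp
  qed
  \<comment> \<open>The slope intervals keep both rays inside the quadrant, on either side of the
    diagonal and at a positive angle to it. The upper limit 3 is the one in
    \<open>vertical_powr_weight_bound\<close>.\<close>
  obtain m1 where m1: "1/4 \<le> m1" "m1 \<le> 1/2"
    and N1: "(\<integral>\<^sup>+t. indicator {0<..} t * (ennreal t * ennreal (cmod (h (Complex t (t * m1))) powr p)) \<partial>lborel) < \<infinity>"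
    using ex_slope_nn_integral_finite[OF \<phi>_meas \<phi>_fin, of "1/4" "1/2"] by (auto simp: \<phi>_def)
  obtain m2 where m2: "2 \<le> m2" "m2 \<le> 3"
    and N2: "(\<integral>\<^sup>+t. indicator {0<..} t * (ennreal t * ennreal (cmod (h (Complex t (t * m2))) powr p)) \<partial>lborel) < \<infinity>"
    using ex_slope_nn_integral_finite[OF \<phi>_meas \<phi>_fin, of 2 3] by (auto simp: \<phi>_def)
  obtain C where C: "0 \<le> C" "\<And>X. 0 < X \<Longrightarrow> \<exists>x\<in>{X..2*X}. (\<integral>\<^sup>+y. \<phi> (Complex x y) \<partial>lborel) \<le> ennreal (C / x)"
    using ex_abscissa_nn_integral_le[OF \<phi>_meas \<phi>_fin] by blast
  define F1 F2 where "F1 = ray_transform m1 g" and "F2 = ray_transform m2 g"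
  define S1 S2 where "S1 = {z. 0 < Im z \<and> Re z \<le> Im z}" and "S2 = {z. 0 < Re z \<and> Im z \<le> Re z}"
  have g_eq: "g = (\<lambda>z. h z * z powr s)" by (simp add: g_def fun_eq_iff)
  note weight = ray_transform_powr_weight[OF p s_def h_meas g_meas[unfolded g_eq], folded g_eq]
  have ri: "ray_integrable m1 g" "ray_integrable m2 g" using weight(1) N1 N2 by auto
  have jump: "F1 z = g z + F2 z" if "0 < Re z" "m1 * Re z < Im z" "Im z < m2 * Re z" for z
    unfolding F1_def F2_def
  proof (rule ray_transform_jump[OF open_half_planes(3) convex_first_quadrant g_hol g_meas _ _ ri _ _ that])
    show "w \<in> first_quadrant" if w: "0 < Re w" "m1 * Re w \<le> Im w" for w
    proof -
      have "0 < m1 * Re w" using w m1 by simp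
      with w show ?thesis by (simp add: first_quadrant_def right_half_plane_def upper_half_plane_def)
    qed
    show "0 \<le> 4 powr (3/2) * (3 + C)" using C by simp
    show "\<exists>x\<in>{X..2*X}. (\<integral>\<^sup>+y. indicator {x * m1..x * m2} y * ennreal (cmod (g (Complex x y))) \<partial>lborel) \<le> ennreal (4 powr (3/2) * (3 + C) * sqrt x)"
      if X: "0 < X" for X
    proof -
      obtain x where x: "x \<in> {X..2*X}" "(\<integral>\<^sup>+y. \<phi> (Complex x y) \<partial>lborel) \<le> ennreal (C / x)" using C(2)[OF X] by blast
      have "(\<integral>\<^sup>+y. indicator {x * m1..x * m2} y * ennreal (cmod (g (Complex x y))) \<partial>lborel) \<le> ennreal (4 powr (3/2) * (3 + C) * sqrt x)"
        unfolding g_def using x X m1 m2 C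
        by (intro vertical_powr_weight_bound[OF p s_def h_meas]) (auto simp: \<phi>_def)
      with x show ?thesis by blast
    qed
  qed (use m1 m2 in auto)
  \<comment> \<open>The cone constant is 1/4: for \<open>Re z < 0\<close> it comes from
    \<open>1/4 \<le> m1\<close>, otherwise from \<open>m1 \<le> 1/2\<close> and
    \<open>Re z \<le> Im z\<close>. The number 17 is \<open>1 + 4 * (1 + 3)\<close>, the value
    needed in \<open>sep2\<close> for slope 3, and it exceeds what is needed here.\<close>
  have sep1: "t + cmod z \<le> 17 * cmod (Complex t (t * m1) - z)" if "z \<in> S1" "0 < t" for z t
  proof -
    have "\<bar>m1 * Re z\<bar> \<le> 1/2 * \<bar>Re z\<bar>" "1/4 * \<bar>Re z\<bar> \<le> \<bar>m1 * Re z\<bar>" 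
      using mult_right_mono[of m1 "1/2" "\<bar>Re z\<bar>"] mult_right_mono[of "1/4" m1 "\<bar>Re z\<bar>"] m1 by (auto simp: abs_mult)
    moreover have "0 \<le> Re z \<Longrightarrow> 0 \<le> m1 * Re z" "Re z \<le> 0 \<Longrightarrow> m1 * Re z \<le> 0" using m1 by (auto simp: mult_nonneg_nonpos)
    ultimately have "1/4 * (\<bar>Re z\<bar> + \<bar>Im z\<bar>) \<le> \<bar>Im z - m1 * Re z\<bar>"
      using that(1) unfolding S1_def mem_Collect_eq by argo
    moreover have "1/4 * cmod z \<le> 1/4 * (\<bar>Re z\<bar> + \<bar>Im z\<bar>)" using cmod_le[of z] by simp
    ultimately have "1/4 * cmod z \<le> \<bar>Im z - m1 * Re z\<bar>" by (rule order_trans[rotated])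
    then have "t + cmod z \<le> (1 + 2 * (1 + \<bar>m1\<bar>) / (1/4)) * cmod (Complex t (t * m1) - z)" by (intro ray_separation) auto
    also have "\<dots> \<le> 17 * cmod (Complex t (t * m1) - z)" using m1 by (intro mult_right_mono) auto
    finally show ?thesis .
  qed
  have sep2: "t + cmod z \<le> 17 * cmod (Complex t (t * m2) - z)" if "z \<in> S2" "0 < t" for z t
  proof -
    have "2 * Re z \<le> m2 * Re z" using m2 that by (intro mult_right_mono) (auto simp: S2_def)
    then have "1/2 * (\<bar>Re z\<bar> + \<bar>Im z\<bar>) \<le> \<bar>Im z - m2 * Re z\<bar>"
      using that(1) unfolding S2_def mem_Collect_eq by argo
    moreover have "1/2 * cmod z \<le> 1/2 * (\<bar>Re z\<bar> + \<bar>Im z\<bar>)" using cmod_le[of z] by simp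
    ultimately have "1/2 * cmod z \<le> \<bar>Im z - m2 * Re z\<bar>" by (rule order_trans[rotated])
    then have "t + cmod z \<le> (1 + 2 * (1 + \<bar>m2\<bar>) / (1/2)) * cmod (Complex t (t * m2) - z)" by (intro ray_separation) auto
    also have "\<dots> \<le> 17 * cmod (Complex t (t * m2) - z)" using m2 by (intro mult_right_mono) auto
    finally show ?thesis .
  qed
  define \<beta> \<gamma> where "\<beta> z = indicator S1 z * ennreal (cmod (F1 z / z powr s) powr p)"
    and "\<gamma> z = indicator S2 z * ennreal (cmod (F2 z / z powr s) powr p)" for z
  have fin: "(\<integral>\<^sup>+z. \<beta> z \<partial>lborel) < \<infinity>" "(\<integral>\<^sup>+z. \<gamma> z \<partial>lborel) < \<infinity>"
    unfolding \<beta>_def \<gamma>_def F1_def F2_def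
    by (rule weight(2)[OF N1 _ _ sep1] weight(2)[OF N2 _ _ sep2]; simp add: S1_def S2_def)+
  have meas: "\<beta> \<in> borel_measurable borel" "\<gamma> \<in> borel_measurable borel"
  proof -
    have [measurable]: "S1 \<in> sets borel" "S2 \<in> sets borel" unfolding S1_def S2_def by measurable
    have [measurable]: "F1 \<in> borel_measurable borel" "F2 \<in> borel_measurable borel"
      unfolding F1_def F2_def ray_transform_def by measurable
    show "\<beta> \<in> borel_measurable borel" "\<gamma> \<in> borel_measurable borel" unfolding \<beta>_def \<gamma>_def by measurable
  qed
  \<comment> \<open>On either side of the diagonal the two numerators add up to \<open>g\<close>,
    and \<open>F1\<close> is evaluated only on \<open>S1\<close>, \<open>F2\<close> only on
    \<open>S2\<close>. By \<open>jump\<close> both formulas agree throughout the sector, so the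
    diagonal is no barrier to holomorphy.\<close>
  define f1 f2 where "f1 z = (if Re z \<le> Im z then F1 z else g z + F2 z) / z powr s"
    and "f2 z = (if Re z \<le> Im z then g z - F1 z else - F2 z) / z powr s" for z
  have F_hol: "F1 holomorphic_on T" if "T \<subseteq> {z. m1 * Re z < Im z}" for T
    unfolding F1_def using that by (intro ray_transform_holomorphic ri) auto
  have F_hol2: "F2 holomorphic_on T" if "T \<subseteq> {z. Im z < m2 * Re z}" for T
    unfolding F2_def using that by (intro ray_transform_holomorphic ri) auto
  have slopes: "m1 * Re z < Re z" "Re z < m2 * Re z" if "0 < Re z" for z
    using m1 m2 that by simp_all
  have cover: "m1 * Re z < Im z \<or> Im z < m2 * Re z" if "0 < Re z" for z
    using slopes[OF that] by linarith
  have jump_below: "F1 z = g z + F2 z" if "0 < Re z" "m1 * Re z < Im z" "Im z \<le> Re z" for z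
    using that slopes(2)[OF that(1)] by (intro jump) linarith+
  have jump_above: "F1 z = g z + F2 z" if "0 < Re z" "Re z \<le> Im z" "Im z < m2 * Re z" for z
    using that slopes(1)[OF that(1)] by (intro jump) linarith+
  show ?thesis
  proof (intro bexI ballI)
    fix z assume z: "z \<in> first_quadrant"
    then have "z \<noteq> 0" by (auto simp: first_quadrant_def right_half_plane_def)
    then have "f z = f1 z + f2 z"
      using z by (simp add: f1_def f2_def g_def h_def field_simps)
    then show "f z = restrict f1 upper_half_plane z + restrict f2 right_half_plane z"
      using z by (simp add: first_quadrant_def)
  next
    show "restrict f1 upper_half_plane \<in> bergman_space p upper_half_plane"
    proof (rule bergman_spaceI[OF open_half_planes(1)])
      let ?A = "{z. 0 < Im z} \<inter> {z. m1 * Re z < Im z}" and ?B = "{z. 0 < Im z} \<inter> {z. Im z < m2 * Re z}"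
      \<comment> \<open>Thus \<open>?B\<close> lies in the quadrant, where \<open>g\<close> is
        holomorphic.\<close>
      have B: "0 < Re z" if "z \<in> ?B" for z
      proof (rule ccontr)
        assume "\<not> 0 < Re z"
        then have "m2 * Re z \<le> 0" using m2 by (intro mult_nonneg_nonpos) auto
        then show False using that by simp
      qed
      \<comment> \<open>Above the diagonal \<open>f1\<close> has this form by definition, below it
        by \<open>jump_below\<close>; on \<open>?B\<close> the roles are exchanged.\<close>
      have "f1 holomorphic_on ?A"
      proof (rule holomorphic_transform)
        show "(\<lambda>z. F1 z / z powr s) holomorphic_on ?A"
          by (intro holomorphic_on_divide F_hol hol_powr) (auto simp: upper_half_plane_def)
        show "F1 z / z powr s = f1 z" if "z \<in> ?A" for z
          using that jump_below[of z] by (auto simp: f1_def)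
      qed
      moreover have "f1 holomorphic_on ?B"
      proof (rule holomorphic_transform)
        show "(\<lambda>z. (g z + F2 z) / z powr s) holomorphic_on ?B"
          using B by (intro holomorphic_on_divide holomorphic_on_add F_hol2 hol_powr holomorphic_on_subset[OF g_hol])
            (auto simp: first_quadrant_def right_half_plane_def upper_half_plane_def)
        show "(g z + F2 z) / z powr s = f1 z" if "z \<in> ?B" for z
          using that jump_above[of z] B[OF that] by (auto simp: f1_def)
      qed
      ultimately have "f1 holomorphic_on ?A \<union> ?B"
        by (intro holomorphic_on_Un open_Int open_Collect_less continuous_intros)
      moreover have "upper_half_plane \<subseteq> ?A \<union> ?B"
      proof
        fix z assume z: "z \<in> upper_half_plane"
        show "z \<in> ?A \<union> ?B"
        proof (cases "0 < Re z")
          case True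
          then show ?thesis using z cover[OF True] unfolding upper_half_plane_def by blast
        next
          case False
          then have "m1 * Re z \<le> 0" using m1 by (simp add: mult_nonneg_nonpos)
          then show ?thesis using z by (auto simp: upper_half_plane_def)
        qed
      qed
      ultimately show "f1 holomorphic_on upper_half_plane" by (rule holomorphic_on_subset)
      show "(\<integral>\<^sup>+z. indicator upper_half_plane z * ennreal (cmod (f1 z) powr p) \<partial>lborel) < \<infinity>"
      \<comment> \<open>Above the diagonal only \<open>\<beta>\<close> is needed. Below it, dividing
        by the weight gives \<open>h\<close> plus a Cauchy integral, bounded through
        \<open>\<phi>\<close> and \<open>\<gamma>\<close>.\<close>
      proof (rule nn_integral_powr_add_finite[OF \<phi>_meas meas _ \<phi>_fin fin])
        fix z assume z: "z \<in> upper_half_plane"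
        show "\<exists>a\<ge>0. \<exists>b\<ge>0. cmod (f1 z) \<le> a + b \<and> ennreal (a powr p) \<le> \<phi> z \<and> ennreal (b powr p) \<le> \<beta> z + \<gamma> z"
        proof (cases "Re z \<le> Im z")
          case True
          then have "z \<in> S1" using z by (simp add: S1_def upper_half_plane_def)
          with True show ?thesis
            by - (rule exI[of _ 0], rule conjI, simp, rule exI[of _ "cmod (F1 z / z powr s)"], auto simp: f1_def \<beta>_def)
        next
          case False
          then have "z \<in> S2" using z by (simp add: S2_def upper_half_plane_def)
          moreover have "f1 z = h z + F2 z / z powr s"
          proof -
            have "z \<noteq> 0" using z by (auto simp: upper_half_plane_def)
            then show ?thesis using False by (simp add: f1_def g_def add_divide_distrib)
          qed
          ultimately show ?thesis
            by - (rule exI[of _ "cmod (h z)"], rule conjI, simp, rule exI[of _ "cmod (F2 z / z powr s)"],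
               auto simp: \<phi>_def \<gamma>_def norm_triangle_ineq)
        qed
      qed (use p in auto)
    qed
    show "restrict f2 right_half_plane \<in> bergman_space p right_half_plane"
    proof (rule bergman_spaceI[OF open_half_planes(2)])
      let ?A = "{z. 0 < Re z} \<inter> {z. m1 * Re z < Im z}" and ?B = "{z. 0 < Re z} \<inter> {z. Im z < m2 * Re z}"
      \<comment> \<open>The mirror image of the argument for \<open>f1\<close>: now it is
        \<open>?A\<close> that lies in the quadrant and needs \<open>g\<close>.\<close>
      have A: "0 < Im z" if "z \<in> ?A" for z
      proof -
        have "0 < m1 * Re z" using that m1 by simp
        then show ?thesis using that by auto
      qed
      have "f2 holomorphic_on ?A"
      proof (rule holomorphic_transform)
        show "(\<lambda>z. (g z - F1 z) / z powr s) holomorphic_on ?A"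
          using A by (intro holomorphic_on_divide holomorphic_on_diff F_hol hol_powr holomorphic_on_subset[OF g_hol])
            (auto simp: first_quadrant_def right_half_plane_def upper_half_plane_def)
        show "(g z - F1 z) / z powr s = f2 z" if "z \<in> ?A" for z
          using that jump_below[of z] by (auto simp: f2_def)
      qed
      moreover have "f2 holomorphic_on ?B"
      proof (rule holomorphic_transform)
        show "(\<lambda>z. - F2 z / z powr s) holomorphic_on ?B"
          by (intro holomorphic_on_divide holomorphic_on_minus F_hol2 hol_powr) (auto simp: right_half_plane_def)
        show "- F2 z / z powr s = f2 z" if "z \<in> ?B" for z
          using that jump_above[of z] by (auto simp: f2_def)
      qed
      ultimately have "f2 holomorphic_on ?A \<union> ?B"
        by (intro holomorphic_on_Un open_Int open_Collect_less continuous_intros)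
      moreover have "right_half_plane \<subseteq> ?A \<union> ?B"
      proof
        fix z assume z: "z \<in> right_half_plane"
        then have "0 < Re z" by (simp add: right_half_plane_def)
        with cover[OF this] show "z \<in> ?A \<union> ?B" by blast
      qed
      ultimately show "f2 holomorphic_on right_half_plane" by (rule holomorphic_on_subset)
      show "(\<integral>\<^sup>+z. indicator right_half_plane z * ennreal (cmod (f2 z) powr p) \<partial>lborel) < \<infinity>"
      proof (rule nn_integral_powr_add_finite[OF \<phi>_meas meas _ \<phi>_fin fin])
        fix z assume z: "z \<in> right_half_plane"
        show "\<exists>a\<ge>0. \<exists>b\<ge>0. cmod (f2 z) \<le> a + b \<and> ennreal (a powr p) \<le> \<phi> z \<and> ennreal (b powr p) \<le> \<beta> z + \<gamma> z"
        proof (cases "Re z \<le> Im z")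
          case True
          then have "z \<in> S1" using z by (simp add: S1_def right_half_plane_def)
          moreover have "f2 z = h z - F1 z / z powr s"
          proof -
            have "z \<noteq> 0" using z by (auto simp: right_half_plane_def)
            then show ?thesis using True by (simp add: f2_def g_def diff_divide_distrib)
          qed
          ultimately show ?thesis
            by - (rule exI[of _ "cmod (h z)"], rule conjI, simp, rule exI[of _ "cmod (F1 z / z powr s)"],
               auto simp: \<phi>_def \<beta>_def norm_triangle_ineq4)
        next
          case False
          then have "z \<in> S2" using z by (simp add: S2_def right_half_plane_def)
          with False show ?thesis
            by - (rule exI[of _ 0], rule conjI, simp, rule exI[of _ "cmod (F2 z / z powr s)"], auto simp: f2_def \<gamma>_def)
        qed
      qed (use p in auto)
    qed
  qed
qed

theorem theorem1p3:
  fixes p :: real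
  assumes "1 < p"
  shows "sum_on first_quadrant (bergman_space p upper_half_plane) (bergman_space p right_half_plane)
         = bergman_space p first_quadrant"
proof
  show "sum_on first_quadrant (bergman_space p upper_half_plane) (bergman_space p right_half_plane)
      \<subseteq> bergman_space p first_quadrant"
    using assms by (intro sum_on_bergman_space_subset) simp
  show "bergman_space p first_quadrant
      \<subseteq> sum_on first_quadrant (bergman_space p upper_half_plane) (bergman_space p right_half_plane)"
  proof
    fix f assume f: "f \<in> bergman_space p first_quadrant"
    obtain f1 f2 where f12: "f1 \<in> bergman_space p upper_half_plane" "f2 \<in> bergman_space p right_half_plane"
      "\<forall>z\<in>first_quadrant. f z = f1 z + f2 z"
      using quadrant_decomposition[OF assms f] by blast
    \<comment> \<open>Both sides are \<open>undefined\<close> off the quadrant, so agreement on it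
      gives equality of functions.\<close>
    have "f = restrict (\<lambda>z. f1 z + f2 z) first_quadrant"
      using bergman_spaceD(1)[OF f] f12(3) by (auto simp: fun_eq_iff restrict_def extensional_def)
    with f12 show "f \<in> sum_on first_quadrant (bergman_space p upper_half_plane) (bergman_space p right_half_plane)"
      by (auto simp: sum_on_def)
  qed
qed

end
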